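(* Let $\mathbb{T}$ be a time scale, $a,b\in\mathbb{T}$ with $a<b$, and $\mathbb{T}_\ast=[a,b]_{\mathbb{T}}$. Let $F\in C_{\mathrm{rd}}[\mathbb{T}_\ast\times\mathbb{R}\times\mathbb{R},\mathbb{R}]$, $K\in C_{\mathrm{rd}}[\mathbb{T}_\ast\times\mathbb{R},\mathbb{R}]$ and $u_a\in\mathbb{R}$, and consider the initial value problem $$u^\Delta(t)=F\left(t,u(t),\int_a^t K(t,u(s))\Delta s\right),\quad t\in\mathbb{T}_\ast^{\kappa},\qquad u(a)=u_a,$$ with $u\in C^1_{\mathrm{rd}}[\mathbb{T}_\ast]$. Assume that this problem has a unique solution, denoted $u_\ast(t)$. Assume that $$|K(t,u)|\leq h(t)\Phi(|u|)\quad\text{for all } t\in\mathbb{T}_\ast^{\kappa},\ u\in\mathbb{R},\qquad |F(t,u,v)|\leq|u|+|v|\quad\text{for all } t\in\mathbb{T}_\ast,\ u,v\in\mathbb{R},$$ where $h:\mathbb{T}_\ast^{\kappa}\to\mathbb{R}$ is a nonnegative rd-continuous function and $\Phi\in C(\mathbb{R}^+_0,\mathbb{R}^+_0)$ is a nondecreasing, subadditive and submultiplicative function such that $\Phi(x)>0$ for $x>0$. Define $$p(t)=1+\int_a^t e_1(t,\sigma(s))\Delta s,\qquad \xi=\int_a^{\rho(b)}\Phi(p(s)|u_a|)\Delta s,\qquad \Psi(x)=\int_{x_0}^x\frac{1}{\Phi(s)}\,ds,\quad x>0,\ x_0>0,$$ and let $\Psi^{-1}$ be the inverse of $\Psi$.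 Then for all $t\in\mathbb{T}_\ast$ such that $$\Psi(\xi)+\int_a^{\rho(t)}\Phi(p(\tau))\Phi\left(\int_a^\tau h(\theta)\Delta\theta\right)\Delta\tau\in \mathrm{Dom}(\Psi^{-1}),$$ we have the estimate $$|u_\ast(t)|\leq p(t)\left\{|u_a|+\int_a^t h(s)\Psi^{-1}\left(\Psi(\xi)+\int_a^s\Phi(p(\tau))\Phi\left(\int_a^\tau h(\theta)\Delta\theta\right)\Delta\tau\right)\Delta s\right\}.$$
   Context: A time scale $\mathbb{T}$ is a nonempty closed subset of $\mathbb{R}$. $\mathbb{R}^+_0=[0,\infty)$. For $a<b$ in $\mathbb{T}$, $[a,b]_{\mathbb{T}}=\{t\in\mathbb{T}:a\leq t\leq b\}$, and $\mathbb{T}_\ast=[a,b]_{\mathbb{T}}$ is regarded as a time scale itself. On $\mathbb{T}_\ast$: $\sigma(t)=\inf\{s\in\mathbb{T}_\ast:s>t\}$ (with $\sigma(b)=b$), $\rho(t)=\sup\{s\in\mathbb{T}_\ast:s<t\}$ (with $\rho(a)=a$). $\mathbb{T}_\ast^{\kappa}=\mathbb{T}_\ast\setminus\{b\}$ if $\rho(b)<b$ and $\mathbb{T}_\ast^{\kappa}=\mathbb{T}_\ast$ otherwise. $u^\Delta$ is the (Hilger) delta derivative and $\int\cdot\,\Delta s$ the delta integral. A function on a time scale is rd-continuous if it is continuous at right-dense points ($\sigma(t)=t$) and has finite left-sided limits at left-dense points ($\rho(t)=t$). $C^1_{\mathrm{rd}}[\mathbb{T}_\ast]$ is the set of delta differentiable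 functions on $\mathbb{T}_\ast$ with rd-continuous delta derivative. $C_{\mathrm{rd}}[\mathbb{T}_\ast\times\mathbb{R}^n,\mathbb{R}]$ denotes rd-continuous functions of several variables in the usual sense: $t\mapsto F(t,x(t))$ is rd-continuous for every continuous $x:\mathbb{T}_\ast\to\mathbb{R}^n$. $e_1(\cdot,s)$ is the time scale exponential function of the constant function $1$: the unique solution of $y^\Delta=y$, $y(s)=1$. Subadditive: $\Phi(x+y)\le\Phi(x)+\Phi(y)$; submultiplicative: $\Phi(xy)\le\Phi(x)\Phi(y)$, for all $x,y\ge0$. $\Psi$ is defined on $(0,\infty)$ with a fixed $x_0>0$, and $\mathrm{Dom}(\Psi^{-1})$ is the range of $\Psi$. *)

theory Defs
  imports "HOL-Analysis.Analysis"
begin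

definition fwd_jump :: "real set \<Rightarrow> real \<Rightarrow> real" where
  "fwd_jump T t = (if {s \<in> T. t < s} = {} then t else Inf {s \<in> T. t < s})"

definition bwd_jump :: "real set \<Rightarrow> real \<Rightarrow> real" where
  "bwd_jump T t = (if {s \<in> T. s < t} = {} then t else Sup {s \<in> T. s < t})"

(* T^kappa: a left-scattered maximum is removed. *)
definition ts_kappa :: "real set \<Rightarrow> real set" where
  "ts_kappa T = {t \<in> T. \<not> ((\<forall>s\<in>T. s \<le> t) \<and> bwd_jump T t < t)}"

(* rd-continuity of a function with domain A, where A is T itself or T^kappa. Density is always
   judged in T, so the maximum of T^kappa may count as right-scattered. *)
definition rd_continuous_on :: "real set \<Rightarrow> real set \<Rightarrow> (real \<Rightarrow> real) \<Rightarrow> bool" where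
  "rd_continuous_on T A f \<longleftrightarrow>
     (\<forall>t\<in>A. (fwd_jump T t = t \<longrightarrow> continuous (at t within A) f) \<and>
            (bwd_jump T t = t \<longrightarrow> (\<exists>l. (f \<longlongrightarrow> l) (at t within (A \<inter> {..<t})))))"

definition rd_continuous_several ::
    "real set \<Rightarrow> (real \<Rightarrow> 'v::euclidean_space \<Rightarrow> real) \<Rightarrow> bool" where
  "rd_continuous_several T F \<longleftrightarrow>
     (\<forall>x. continuous_on T x \<longrightarrow> rd_continuous_on T T (\<lambda>t. F t (x t)))"

(* Hilger derivative. The value D is determined only for t in T^kappa. *)
definition has_delta_derivative :: "real set \<Rightarrow> (real \<Rightarrow> real) \<Rightarrow> real \<Rightarrow> real \<Rightarrow> bool" where
  "has_delta_derivative T f D t \<longleftrightarrow>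
     (\<forall>e>0. \<exists>d>0. \<forall>s\<in>T. \<bar>s - t\<bar> < d \<longrightarrow>
        \<bar>(f (fwd_jump T t) - f s) - D * (fwd_jump T t - s)\<bar> \<le> e * \<bar>fwd_jump T t - s\<bar>)"

definition C1_rd :: "real set \<Rightarrow> (real \<Rightarrow> real) set" where
  "C1_rd T = {u. \<exists>u'. (\<forall>t\<in>ts_kappa T. has_delta_derivative T u (u' t) t) \<and>
                      rd_continuous_on T (ts_kappa T) u'}"

(* Cauchy delta integral over [c,d], c <= d, as the increment of an antiderivative G.
   G is only required to be continuous (not differentiable) at d: the integral does not see
   f d, and if d is left-dense and right-scattered in T, then d becomes right-dense in
   [c,d], where an rd-continuous f on T need not have a derivative-compatible value at d.
   The restriction of an antiderivative on all of T always qualifies as G. *)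
definition has_delta_integral ::
    "real set \<Rightarrow> (real \<Rightarrow> real) \<Rightarrow> real \<Rightarrow> real \<Rightarrow> real \<Rightarrow> bool" where
  "has_delta_integral T f c d I \<longleftrightarrow>
     (\<exists>G. continuous_on (T \<inter> {c..d}) G \<and>
          (\<forall>s\<in>T \<inter> {c..<d}. has_delta_derivative (T \<inter> {c..d}) G (f s) s) \<and>
          I = G d - G c)"

definition delta_integrable :: "real set \<Rightarrow> (real \<Rightarrow> real) \<Rightarrow> real \<Rightarrow> real \<Rightarrow> bool" where
  "delta_integrable T f c d \<longleftrightarrow> (\<exists>I. has_delta_integral T f c d I)"

definition delta_integral :: "real set \<Rightarrow> real \<Rightarrow> real \<Rightarrow> (real \<Rightarrow> real) \<Rightarrow> real" where
  "delta_integral T c d f = (THE I. has_delta_integral T f c d I)"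

(* e_q(t,s): the value at t of the solution of y^Delta = q y, y(s) = 1. The description ranges
   over the value because y itself is unique only on T. *)
definition ts_exp :: "real set \<Rightarrow> (real \<Rightarrow> real) \<Rightarrow> real \<Rightarrow> real \<Rightarrow> real" where
  "ts_exp T q t s = (THE z. \<exists>y. (\<forall>r\<in>ts_kappa T. has_delta_derivative T y (q r * y r) r) \<and>
                              y s = 1 \<and> z = y t)"

(* The equation at t is taken to include existence of the inner integral. *)
definition ivp_solution ::
    "real set \<Rightarrow> real \<Rightarrow> (real \<Rightarrow> real \<Rightarrow> real \<Rightarrow> real) \<Rightarrow> (real \<Rightarrow> real \<Rightarrow> real) \<Rightarrow> real \<Rightarrow>
     (real \<Rightarrow> real) \<Rightarrow> bool" where
  "ivp_solution T a F K ua u \<longleftrightarrow>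
     u \<in> C1_rd T \<and> u a = ua \<and>
     (\<forall>t\<in>ts_kappa T.
        delta_integrable T (\<lambda>s. K t (u s)) a t \<and>
        has_delta_derivative T u (F t (u t) (delta_integral T a t (\<lambda>s. K t (u s)))) t)"

end

theory Submission
  imports Defs
begin

text \<open>
  \<open>e_1(t, \<sigma>(s))\<close> is the delta derivative in \<open>s\<close> of \<open>- e_1(t, a) / e_1(s, a)\<close>, so
  \<open>p(t) = e_1(t, a)\<close>. With \<open>z(t) = \<integral>_a^t \<Phi>(|u|)\<close> the equation gives
  \<open>|u(t)| \<le> |u_a| + \<integral>_a^t (|u| + h z)\<close>, and the quotient rule applied to the right-hand side over
  \<open>e_1\<close> yields \<open>|u| \<le> p (|u_a| + \<integral> h z)\<close>. Since \<open>z\<close> is nondecreasing,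
  \<open>\<integral>_a^t h z \<le> z(t) \<integral>_a^t h\<close>, hence \<open>\<Phi>(|u|) \<le> \<Phi>(p |u_a|) + g \<Phi>(z)\<close> with \<open>g = \<Phi>(p) \<Phi>(\<integral> h)\<close>.
  So \<open>z\<close> is bounded by \<open>Z = \<xi> + \<integral> g \<Phi>(z)\<close>, and \<open>\<Psi>(Z)\<close> grows at most as fast as \<open>\<integral> g\<close>.
\<close>

text \<open>A delta integral is the increment of some antiderivative, so an integral must first be
  shown to have one, while comparing integrals only takes monotonicity: the inequalities rest on the
  fact that a nonnegative derivative forces growth. The Dini form of this fact is needed because
  \<open>\<Psi>\<close> of \<open>Z\<close> obeys no chain rule at scattered points;
  \<open>\<Psi>\<close> is concave, as \<open>\<Phi>\<close> is nondecreasing, and its tangent lines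
  serve instead. The backward jumps in the statement come from half-open integration. The bound at
  \<open>t\<close> only uses points \<open>s < t\<close>, and these lie at or before the backward
  jumps of \<open>t\<close> and of \<open>b\<close>. Hence the integral of
  \<open>\<Phi> (p * |ua|)\<close> up to \<open>s\<close> is at most \<open>xi\<close>, and the
  argument of \<open>\<Psi>inv\<close> at \<open>s\<close> does not exceed the value assumed to be
  in the range of \<open>\<Psi>\<close>. Replacing that integral by the constant \<open>xi\<close>
  removes the inhomogeneous term from the inequality for \<open>Z\<close>.\<close>

lemma right_continuous_imp_borel_measurable:
  fixes f :: "real \<Rightarrow> real"
  assumes "\<And>x. (f \<longlongrightarrow> f x) (at_right x)"
  shows "f \<in> borel_measurable borel"
proof (rule borel_measurable_LIMSEQ_real)
  \<comment> \<open>\<open>r n x\<close> is the least point of the grid of mesh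
    \<open>1 / (n + 1)\<close> that is strictly greater than \<open>x\<close>. So
    \<open>f (r n x)\<close> depends on an integer only, and strictness puts the sequence into
    \<open>at_right x\<close>.\<close>
  define r where "r n x = (of_int \<lfloor>real (Suc n) * x\<rfloor> + 1) / real (Suc n)" for n :: nat and x :: real
  show "(\<lambda>x. f (r n x)) \<in> borel_measurable borel" for n
  proof -
    have "(\<lambda>x. \<lfloor>real (Suc n) * x\<rfloor>) \<in> measurable borel (count_space UNIV)"
      by measurable
    then show ?thesis
      unfolding r_def
      by (rule measurable_compose[where g = "\<lambda>k. f ((of_int k + 1) / real (Suc n))"]) simp
  qed
  fix x :: real
  have gt: "x < r n x" for n
    unfolding r_def by (simp add: field_simps del: of_nat_Suc) linarith
  have le: "r n x \<le> x + inverse (real (Suc n))" for n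
    unfolding r_def by (simp add: field_simps del: of_nat_Suc) 
  have "(\<lambda>n. x + inverse (real (Suc n))) \<longlonglongrightarrow> x"
    using tendsto_add[OF tendsto_const LIMSEQ_inverse_real_of_nat, of x] by simp
  then have "(\<lambda>n. r n x) \<longlonglongrightarrow> x"
    by (rule tendsto_sandwich[OF _ _ tendsto_const, rotated -1])
       (use less_imp_le[OF gt] le in \<open>auto simp del: of_nat_Suc\<close>)
  then have "filterlim (\<lambda>n. r n x) (at_right x) sequentially"
    using gt by (simp add: filterlim_at less_imp_neq[THEN not_sym])
  then show "(\<lambda>n. f (r n x)) \<longlonglongrightarrow> f x"
    by (rule filterlim_compose[OF assms])
qed

text \<open>With the graininess as \<open>x\<close>, this is the growth rate whose delta integral is
  the logarithm of the exponential; continuity at 0 joins scattered points to dense ones.\<close>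

lemma isCont_ln_quotient:
  "isCont (\<lambda>x::real. if x = 0 then 1 else ln (1 + x) / x) 0"
proof -
  have "((\<lambda>x::real. ln (1 + x)) has_real_derivative 1) (at 0)"
    by (auto intro!: derivative_eq_intros)
  then have "(\<lambda>x::real. ln (1 + x) / x) \<midarrow>0\<rightarrow> 1" by (simp add: DERIV_def)
  moreover have "\<forall>\<^sub>F x in at (0::real). ln (1 + x) / x = (if x = 0 then 1 else ln (1 + x) / x)"
    by (auto simp: eventually_at_filter)
  ultimately have "(\<lambda>x::real. if x = 0 then 1 else ln (1 + x) / x) \<midarrow>0\<rightarrow> 1"
    by (rule Lim_transform_eventually)
  then show ?thesis by (simp add: isCont_def)
qed

text \<open>Meant for the integrand \<open>1 / \<Phi>\<close>, which may blow up at 0: the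
  fundamental theorem is applied on a compact interval around \<open>x0\<close> and \<open>x\<close>
  that stays away from 0.\<close>

lemma interval_integral_has_real_derivative:
  fixes f :: "real \<Rightarrow> real"
  assumes f: "continuous_on {0<..} f" and x0: "0 < x0" and x: "0 < x"
  shows "((\<lambda>y. LBINT s=ereal x0..ereal y. f s) has_real_derivative f x) (at x)"
proof -
  define l r where "l = min x0 x / 2" and "r = max x0 x + 1"
  have "0 < l" "l < x0" "x0 < r" "l < x" "x < r" using x0 x by (auto simp: l_def r_def)
  have "((\<lambda>y. LBINT s=ereal x0..ereal y. f s) has_vector_derivative f x) (at x within {l..r})"
    by (rule interval_integral_FTC2)
       (use \<open>0 < l\<close> \<open>l < x0\<close> \<open>x0 < r\<close> \<open>l < x\<close> \<open>x < r\<close> in \<open>auto intro: continuous_on_subset[OF f]\<close>)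
  then show ?thesis
    unfolding at_within_Icc_at[OF \<open>l < x\<close> \<open>x < r\<close>] has_real_derivative_iff_has_vector_derivative .
qed

subsection \<open>Calculus on a compact time scale\<close>

text \<open>The degenerate case \<open>a = b\<close> is allowed, so that every restriction to
  \<open>{c..d}\<close> with \<open>c \<le> d\<close> is an instance again.\<close>

locale compact_time_scale =
  fixes S :: "real set" and a b :: real
  assumes compact: "compact S" and min_in: "a \<in> S" and max_in: "b \<in> S"
    and bounds: "S \<subseteq> {a..b}"
begin

abbreviation \<sigma> :: "real \<Rightarrow> real" where "\<sigma> \<equiv> fwd_jump S"

lemma in_bounds: "s \<in> S \<Longrightarrow> a \<le> s" "s \<in> S \<Longrightarrow> s \<le> b"
  using bounds by auto

lemma closed: "closed S"
  using compact by (rule compact_imp_closed)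

lemma fwd_jump_ge: "t \<le> \<sigma> t"
  by (auto simp: fwd_jump_def intro!: cInf_greatest)

lemma fwd_jump_le: "r \<in> S \<Longrightarrow> t < r \<Longrightarrow> \<sigma> t \<le> r"
  by (auto simp: fwd_jump_def intro!: cInf_lower bdd_belowI[where m = t])

lemma fwd_jump_mem:
  assumes "t \<in> S" shows "\<sigma> t \<in> S"
proof (cases "{s \<in> S. t < s} = {}")
  case False
  have bdd: "bdd_below {s \<in> S. t < s}" by (auto intro!: bdd_belowI[where m = t])
  have "Inf {s \<in> S. t < s} \<in> closure {s \<in> S. t < s}"
    by (rule closure_contains_Inf[OF False bdd])
  also have "\<dots> \<subseteq> S" using closed by (intro closure_minimal) auto
  finally show ?thesis unfolding fwd_jump_def if_not_P[OF False] .
qed (simp add: fwd_jump_def assms del: Collect_empty_eq)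

lemma right_dense_point:
  assumes "\<sigma> t = t" "t < b" "0 < e"
  obtains r where "r \<in> S" "t < r" "r < t + e"
proof -
  have ne: "{s \<in> S. t < s} \<noteq> {}" using max_in assms by auto
  have "Inf {s \<in> S. t < s} < t + e" using assms unfolding fwd_jump_def if_not_P[OF ne] by simp
  from cInf_lessD[OF ne this] show ?thesis using that by auto
qed

lemma bwd_jump_bounds:
  assumes "t \<in> S"
  shows bwd_jump_mem: "bwd_jump S t \<in> S" and bwd_jump_le: "bwd_jump S t \<le> t"
    and bwd_jump_ge: "\<And>s. s \<in> S \<Longrightarrow> s < t \<Longrightarrow> s \<le> bwd_jump S t"
proof -
  have bdd: "bdd_above {s \<in> S. s < t}" by (auto intro!: bdd_aboveI[where M = t])
  show "bwd_jump S t \<in> S"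
  proof (cases "{s \<in> S. s < t} = {}")
    case False
    have "Sup {s \<in> S. s < t} \<in> closure {s \<in> S. s < t}"
      by (rule closure_contains_Sup[OF False bdd])
    also have "\<dots> \<subseteq> S" using closed by (intro closure_minimal) auto
    finally show ?thesis unfolding bwd_jump_def if_not_P[OF False] .
  qed (simp add: bwd_jump_def assms del: Collect_empty_eq)
  show "bwd_jump S t \<le> t" by (auto simp: bwd_jump_def intro!: cSup_least)
  show "s \<le> bwd_jump S t" if "s \<in> S" "s < t" for s
    using that bdd by (auto simp: bwd_jump_def intro!: cSup_upper)
qed

section \<open>Rules for the Hilger derivative\<close>

lemma delta_derivative_right_dense:
  assumes "\<sigma> t = t"
  shows "has_delta_derivative S f D t \<longleftrightarrow> (f has_real_derivative D) (at t within S)"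
proof -
  have "f t - f s - D * (t - s) = - (f s - f t - D * (s - t))" for s
    by (simp add: algebra_simps)
  then have "\<bar>f t - f s - D * (t - s)\<bar> = \<bar>f s - f t - D * (s - t)\<bar>" for s
    by (metis abs_minus_cancel)
  moreover have "\<bar>t - s\<bar> = \<bar>s - t\<bar>" for s by (rule abs_minus_commute)
  ultimately show ?thesis
    unfolding has_delta_derivative_def has_field_derivative_def has_derivative_within_alt assms
    by (simp add: bounded_linear_mult_right)
qed

text \<open>Taking \<open>s = t\<close> in the Hilger condition gives the jump, and nearby
  \<open>s\<close> give continuity, because \<open>|\<sigma> t - s|\<close> stays comparable to the
  graininess. Together with the right-dense case this reduces the rules below to ordinary
  calculus.\<close>

lemma delta_derivative_right_scattered:
  assumes "t \<in> S" "t < \<sigma> t"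
  shows "has_delta_derivative S f D t \<longleftrightarrow>
    continuous (at t within S) f \<and> f (\<sigma> t) - f t = D * (\<sigma> t - t)" (is "?L \<longleftrightarrow> ?R")
proof
  assume L: ?L
  have "\<bar>f (\<sigma> t) - f t - D * (\<sigma> t - t)\<bar> \<le> e" if "e > 0" for e
  proof -
    have "e / (\<sigma> t - t) > 0" using that assms by simp
    with L obtain d where "d > 0" and d: "\<And>s. s \<in> S \<Longrightarrow> \<bar>s - t\<bar> < d \<Longrightarrow>
        \<bar>(f (\<sigma> t) - f s) - D * (\<sigma> t - s)\<bar> \<le> e / (\<sigma> t - t) * \<bar>\<sigma> t - s\<bar>"
      unfolding has_delta_derivative_def by blast
    from d[of t] \<open>d > 0\<close> assms show ?thesis by simp
  qed
  then have jump: "f (\<sigma> t) - f t = D * (\<sigma> t - t)"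
    by (metis abs_le_zero_iff diff_0_right diff_eq_eq eq_iff_diff_eq_0 field_le_epsilon add_0)
  have "\<exists>d>0. \<forall>s\<in>S. dist s t < d \<longrightarrow> dist (f s) (f t) < e" if "e > 0" for e
  proof -
    define m where "m = \<sigma> t - t"
    have m: "m > 0" using assms by (simp add: m_def)
    \<comment> \<open>Within distance \<open>m\<close> of \<open>t\<close> one has
      \<open>|\<sigma> t - s| \<le> 2 * m\<close>, so this tolerance costs at most
      \<open>e / 2\<close>. The other half pays for the linear term
      \<open>D * (s - t)\<close>.\<close>
    have "e / (4 * m) > 0" using that m by simp
    with L obtain d where "d > 0" and d: "\<And>s. s \<in> S \<Longrightarrow> \<bar>s - t\<bar> < d \<Longrightarrow>
        \<bar>(f (\<sigma> t) - f s) - D * (\<sigma> t - s)\<bar> \<le> e / (4 * m) * \<bar>\<sigma> t - s\<bar>"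
      unfolding has_delta_derivative_def by blast
    have D1: "0 < \<bar>D\<bar> + 1" by linarith
    show ?thesis
    proof (intro exI[of _ "min d (min m (e / (2 * (\<bar>D\<bar> + 1))))"] conjI ballI impI)
      show "0 < min d (min m (e / (2 * (\<bar>D\<bar> + 1))))" using \<open>d > 0\<close> m that D1 by simp
      fix s assume "s \<in> S" and "dist s t < min d (min m (e / (2 * (\<bar>D\<bar> + 1))))"
      then have s: "\<bar>s - t\<bar> < d" "\<bar>s - t\<bar> < m" "\<bar>s - t\<bar> < e / (2 * (\<bar>D\<bar> + 1))"
        by (auto simp: dist_real_def)
      have "\<bar>\<sigma> t - s\<bar> \<le> 2 * m" using s(2) m_def by linarith
      then have "e / (4 * m) * \<bar>\<sigma> t - s\<bar> \<le> e / (4 * m) * (2 * m)"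
        using that m by (intro mult_left_mono) auto
      also have "\<dots> = e / 2" using m by simp
      finally have 1: "\<bar>(f (\<sigma> t) - f s) - D * (\<sigma> t - s)\<bar> \<le> e / 2"
        using d[OF \<open>s \<in> S\<close> s(1)] by linarith
      have 2: "(f (\<sigma> t) - f s) - D * (\<sigma> t - s) = (f t - f s) + D * (s - t)"
        using jump by (simp add: algebra_simps)
      have "\<bar>D * (s - t)\<bar> \<le> (\<bar>D\<bar> + 1) * \<bar>s - t\<bar>"
        unfolding abs_mult by (intro mult_right_mono) auto
      also have "\<dots> < e / 2"
        using s(3) D1 by (simp add: field_simps)
      finally have "\<bar>D * (s - t)\<bar> < e / 2" .
      with 1 2 show "dist (f s) (f t) < e" unfolding dist_real_def by linarith
    qed
  qed
  with jump show ?R by (auto simp: continuous_within_eps_delta)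
next
  assume R: ?R
  define m where "m = \<sigma> t - t"
  have m: "m > 0" using assms by (simp add: m_def)
  show ?L
    unfolding has_delta_derivative_def
  proof (intro allI impI)
    fix e :: real assume "e > 0"
    have "continuous (at t within S) (\<lambda>s. (f t - f s) + D * (s - t))"
      using R by (intro continuous_intros) auto
    then obtain d where "d > 0" and d: "\<forall>s\<in>S. dist s t < d \<longrightarrow>
       dist ((f t - f s) + D * (s - t)) ((f t - f t) + D * (t - t)) < e * m"
      unfolding continuous_within_eps_delta using \<open>e > 0\<close> m by (meson mult_pos_pos)
    show "\<exists>d>0. \<forall>s\<in>S. \<bar>s - t\<bar> < d \<longrightarrow>
      \<bar>f (\<sigma> t) - f s - D * (\<sigma> t - s)\<bar> \<le> e * \<bar>\<sigma> t - s\<bar>"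
    proof (intro exI[of _ "min d m"] conjI ballI impI)
      show "0 < min d m" using \<open>d > 0\<close> m by simp
      fix s assume s: "s \<in> S" "\<bar>s - t\<bar> < min d m"
      \<comment> \<open>The gap after \<open>t\<close> contains no point of the time scale, so a
        point closer than \<open>m\<close> lies at or left of \<open>t\<close> and has distance at
        least \<open>m\<close> from \<open>\<sigma> t\<close>.\<close>
      have "s \<le> t" using fwd_jump_le[OF s(1), of t] s(2) m_def by linarith
      then have "e * m \<le> e * \<bar>\<sigma> t - s\<bar>"
        using \<open>e > 0\<close> m m_def by (intro mult_left_mono) auto
      moreover have "f (\<sigma> t) - f s - D * (\<sigma> t - s) = (f t - f s) + D * (s - t)"
        using R by (simp add: algebra_simps)
      moreover have "\<bar>(f t - f s) + D * (s - t)\<bar> < e * m"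
        using d s by (auto simp: dist_real_def)
      ultimately show "\<bar>f (\<sigma> t) - f s - D * (\<sigma> t - s)\<bar> \<le> e * \<bar>\<sigma> t - s\<bar>"
        by linarith
    qed
  qed
qed

lemma right_cases [case_names dense scattered]:
  obtains "\<sigma> t = t" | "t < \<sigma> t"
  using fwd_jump_ge[of t] by linarith

lemma delta_derivative_imp_continuous:
  assumes "t \<in> S" "has_delta_derivative S f D t"
  shows "continuous (at t within S) f"
  using assms
  by (cases t rule: right_cases)
     (auto simp: delta_derivative_right_dense delta_derivative_right_scattered
       intro: DERIV_continuous)

lemma delta_derivative_add:
  assumes "t \<in> S" "has_delta_derivative S f D t" "has_delta_derivative S g D' t"
  shows "has_delta_derivative S (\<lambda>s. f s + g s) (D + D') t"
  using assms
  by (cases t rule: right_cases)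
     (auto simp: delta_derivative_right_dense delta_derivative_right_scattered algebra_simps
       intro!: derivative_eq_intros continuous_intros)

lemma delta_derivative_cmult:
  assumes "t \<in> S" "has_delta_derivative S f D t"
  shows "has_delta_derivative S (\<lambda>s. c * f s) (c * D) t"
  using assms
  by (cases t rule: right_cases)
     (auto simp: delta_derivative_right_dense delta_derivative_right_scattered 
       simp flip: right_diff_distrib
       intro!: derivative_eq_intros continuous_intros)

lemma delta_derivative_const:
  assumes "t \<in> S" shows "has_delta_derivative S (\<lambda>s. c) 0 t"
  unfolding has_delta_derivative_def by (auto intro: exI[of _ 1])

lemma delta_derivative_minus:
  assumes "t \<in> S" "has_delta_derivative S f D t"
  shows "has_delta_derivative S (\<lambda>s. - f s) (- D) t"
  using delta_derivative_cmult[OF assms, of "-1"] by simp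

lemma delta_derivative_diff:
  assumes "t \<in> S" "has_delta_derivative S f D t" "has_delta_derivative S g D' t"
  shows "has_delta_derivative S (\<lambda>s. f s - g s) (D - D') t"
  using delta_derivative_add[OF assms(1,2) delta_derivative_minus[OF assms(1,3)]] by simp

lemma delta_derivative_divide:
  assumes "t \<in> S" "has_delta_derivative S f D t" "has_delta_derivative S g D' t"
    and "g t \<noteq> 0" "g (\<sigma> t) \<noteq> 0"
  shows "has_delta_derivative S (\<lambda>s. f s / g s) ((D * g t - f t * D') / (g t * g (\<sigma> t))) t"
proof (cases t rule: right_cases)
  case dense
  with assms show ?thesis
    by (auto simp: delta_derivative_right_dense intro!: derivative_eq_intros)
next
  case scattered
  with assms have f: "f (\<sigma> t) = f t + D * (\<sigma> t - t)" and g: "g (\<sigma> t) = g t + D' * (\<sigma> t - t)"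
    by (auto simp: delta_derivative_right_scattered)
  have "f (\<sigma> t) / g (\<sigma> t) - f t / g t = (f (\<sigma> t) * g t - f t * g (\<sigma> t)) / (g t * g (\<sigma> t))"
    using assms(4,5) by (simp add: field_simps)
  also have "\<dots> = (D * g t - f t * D') / (g t * g (\<sigma> t)) * (\<sigma> t - t)"
    unfolding f g by (simp add: algebra_simps)
  finally show ?thesis
    using assms scattered
    by (auto simp: delta_derivative_right_scattered intro!: continuous_intros)
qed

text \<open>Stated with a lower right Dini derivative, so that it also applies to concave functions of
  differentiable ones.\<close>
lemma dini_nonneg_imp_le:
  assumes cont: "continuous_on S f"
    and dini: "\<And>s e. s \<in> S \<Longrightarrow> s < b \<Longrightarrow> 0 < e \<Longrightarrow>
      \<exists>d>0. \<forall>r\<in>S. s < r \<longrightarrow> r < s + d \<or> r = \<sigma> s \<longrightarrow> f s - e * (r - s) \<le> f r"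
  shows "f a \<le> f b"
proof -
  have "f a \<le> f b + e" if "e > 0" for e
  proof -
    \<comment> \<open>The total loss \<open>e\<close> is spread over the interval as a slope; the
      added 1 covers \<open>a = b\<close>.\<close>
    define \<eta> where "\<eta> = e / (b - a + 1)"
    have ab: "a \<le> b" using in_bounds[OF max_in] by simp
    then have \<eta>: "\<eta> > 0" using that by (simp add: \<eta>_def)
    define P where "P r \<longleftrightarrow> f a - \<eta> * (r - a) \<le> f r" for r
    \<comment> \<open>Induction along the time scale: \<open>A\<close> is the initial segment on
      which the tilted inequality holds. Continuity keeps its supremum in it, and the Dini condition
      pushes past any supremum below \<open>b\<close>.\<close>
    define A where "A = {t\<in>S. \<forall>r\<in>S. r \<le> t \<longrightarrow> P r}"
    have aA: "a \<in> A" using in_bounds(1) min_in by (force simp: A_def P_def dest: antisym)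
    have bdd: "bdd_above A" using in_bounds by (auto simp: A_def intro!: bdd_aboveI[where M = b])
    define m where "m = Sup A"
    have below: "P r" if "r \<in> S" "r < m" for r
    proof -
      from that aA obtain q where "q \<in> A" "r < q" using less_cSupD[of A r] by (auto simp: m_def)
      then show ?thesis using \<open>r \<in> S\<close> by (simp add: A_def)
    qed
    have mcl: "m \<in> closure A" unfolding m_def
      using aA by (intro closure_contains_Sup bdd) auto
    also have "closure A \<subseteq> closure {r \<in> S. P r}" by (intro closure_mono) (auto simp: A_def)
    also have "closure {r \<in> S. P r} = {r \<in> S. P r}"
      unfolding P_def
      by (intro closure_closed continuous_on_closed_Collect_le continuous_intros cont closed)
    finally have m: "m \<in> S" "P m" by auto
    then have mA: "m \<in> A" using below by (auto simp: A_def le_less)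
    have "m = b"
    proof (rule ccontr)
      assume "m \<noteq> b"
      then have "m < b" using in_bounds(2)[OF m(1)] by simp
      from dini[OF m(1) this \<eta>] obtain d where "d > 0"
        and d: "\<And>r. r \<in> S \<Longrightarrow> m < r \<Longrightarrow> r < m + d \<or> r = \<sigma> m \<Longrightarrow> f m - \<eta> * (r - m) \<le> f r" by auto
      have Pr: "P r" if "r \<in> S" "m < r" "r < m + d \<or> r = \<sigma> m" for r
      proof -
        have "\<eta> * (r - m) + \<eta> * (m - a) = \<eta> * (r - a)" by (simp add: algebra_simps)
        then show ?thesis using d[OF that] m(2) unfolding P_def by linarith
      qed
      \<comment> \<open>At a scattered \<open>m\<close> the next point may be farther away than
        \<open>d\<close>; this is why the Dini condition mentions \<open>\<sigma> s\<close>
        separately.\<close>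
      obtain r where r: "r \<in> S" "m < r" "r < m + d \<or> r = \<sigma> m"
      proof (cases m rule: right_cases)
        case dense
        from right_dense_point[OF dense \<open>m < b\<close> \<open>d > 0\<close>] that show ?thesis by metis
      next
        case scattered
        with that[of "\<sigma> m"] fwd_jump_mem[OF m(1)] show ?thesis by simp
      qed
      have "P q" if "q \<in> S" "q \<le> r" for q
      proof (cases "q \<le> m")
        case True then show ?thesis using mA that by (auto simp: A_def)
      next
        case False
        then have "m < q" by simp
        moreover have "q < m + d \<or> q = \<sigma> m"
          using r that fwd_jump_le[OF \<open>q \<in> S\<close> \<open>m < q\<close>] by auto
        ultimately show ?thesis using Pr that by blast
      qed
      then have "r \<in> A" using r by (auto simp: A_def)
      then have "r \<le> m" unfolding m_def using bdd by (intro cSup_upper)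
      then show False using r by simp
    qed
    with m have "f a - \<eta> * (b - a) \<le> f b" by (simp add: P_def)
    moreover have "\<eta> * (b - a) \<le> e"
      using ab that unfolding \<eta>_def by (simp add: field_simps)
    ultimately show ?thesis by linarith
  qed
  then show ?thesis by (rule field_le_epsilon)
qed

text \<open>At a scattered point the increment is \<open>D\<close> times the graininess, and a
  radius equal to the graininess leaves \<open>\<sigma> s\<close> as the only candidate. At a dense
  point the slope \<open>e\<close> absorbs the error of the linear approximation.\<close>

lemma delta_derivative_lower:
  assumes s: "s \<in> S" and D: "has_delta_derivative S f D s" "0 \<le> D" and "0 < e"
  shows "\<exists>d>0. \<forall>r\<in>S. s < r \<longrightarrow> r < s + d \<or> r = \<sigma> s \<longrightarrow> f s - e * (r - s) \<le> f r"
proof (cases s rule: right_cases)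
  case scattered
  with s D have "f (\<sigma> s) - f s = D * (\<sigma> s - s)" by (simp add: delta_derivative_right_scattered)
  moreover have "0 \<le> D * (\<sigma> s - s)" "0 \<le> e * (\<sigma> s - s)" using D scattered \<open>0 < e\<close> by auto
  moreover have "r = \<sigma> s" if "r \<in> S" "s < r" "r < s + (\<sigma> s - s)" for r
    using fwd_jump_le[of r s] that by auto
  ultimately show ?thesis using scattered
    by (intro exI[of _ "\<sigma> s - s"]) auto
next
  case dense
  from D(1) \<open>0 < e\<close> obtain d where "d > 0" and d: "\<And>r. r \<in> S \<Longrightarrow> \<bar>r - s\<bar> < d \<Longrightarrow>
      \<bar>f s - f r - D * (s - r)\<bar> \<le> e * \<bar>s - r\<bar>"
    unfolding has_delta_derivative_def dense by blast
  show ?thesis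
  proof (intro exI[of _ d] conjI ballI impI)
    fix r assume r: "r \<in> S" "s < r" "r < s + d \<or> r = \<sigma> s"
    then have "\<bar>f s - f r - D * (s - r)\<bar> \<le> e * (r - s)" using d[of r] dense by auto
    moreover have "0 \<le> D * (r - s)" using r D by auto
    moreover have "D * (s - r) = - (D * (r - s))" by (simp add: algebra_simps)
    ultimately show "f s - e * (r - s) \<le> f r" by linarith
  qed fact
qed

lemma delta_derivative_mono:
  assumes "continuous_on S f" "continuous_on S g"
    and "\<And>s. s \<in> S \<Longrightarrow> s < b \<Longrightarrow> has_delta_derivative S f (f' s) s"
    and "\<And>s. s \<in> S \<Longrightarrow> s < b \<Longrightarrow> has_delta_derivative S g (g' s) s"
    and "\<And>s. s \<in> S \<Longrightarrow> s < b \<Longrightarrow> f' s \<le> g' s"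
  shows "f b - f a \<le> g b - g a"
proof -
  have "g a - f a \<le> g b - f b"
  proof (rule dini_nonneg_imp_le)
    show "continuous_on S (\<lambda>s. g s - f s)" using assms by (intro continuous_intros)
    fix s e assume s: "s \<in> S" "s < b" and e: "(0::real) < e"
    show "\<exists>d>0. \<forall>r\<in>S. s < r \<longrightarrow> r < s + d \<or> r = \<sigma> s \<longrightarrow>
        g s - f s - e * (r - s) \<le> g r - f r"
      using assms(5)[OF s] e
      by (intro delta_derivative_lower[OF s(1) delta_derivative_diff[OF s(1) assms(4,3)[OF s]]]) auto
  qed
  then show ?thesis by linarith
qed

section \<open>Restriction to subintervals and comparison of integrals\<close>

context
  fixes c d assumes c: "c \<in> S" and d: "d \<in> S" and le: "c \<le> d"
begin

lemma restrict: "compact_time_scale (S \<inter> {c..d}) c d"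
  using compact c d le by unfold_locales (auto intro: compact_Int)

text \<open>Capping the points to the right of \<open>s\<close> at \<open>d\<close> does not change
  their infimum as long as \<open>s < d\<close>. At \<open>d\<close> itself the restricted jump is
  \<open>d\<close>, whatever follows in \<open>S\<close>.\<close>

lemma fwd_jump_restrict:
  assumes "s \<in> S" "c \<le> s" "s < d" shows "fwd_jump (S \<inter> {c..d}) s = \<sigma> s"
proof -
  have "\<sigma> s \<le> d" using fwd_jump_le[OF d assms(3)] .
  have ne: "{r \<in> S \<inter> {c..d}. s < r} \<noteq> {}" "{r \<in> S. s < r} \<noteq> {}" using d assms le by auto
  have "Inf {r \<in> S \<inter> {c..d}. s < r} = Inf {r \<in> S. s < r}"
  proof (rule antisym)
    show "Inf {r \<in> S \<inter> {c..d}. s < r} \<le> Inf {r \<in> S. s < r}"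
    proof (rule cInf_greatest[OF ne(2)])
      fix r assume "r \<in> {r \<in> S. s < r}"
      then have "min r d \<in> {r \<in> S \<inter> {c..d}. s < r}" using d assms le by (auto simp: min_def)
      then have "Inf {r \<in> S \<inter> {c..d}. s < r} \<le> min r d"
        by (intro cInf_lower bdd_belowI[where m = s]) auto
      then show "Inf {r \<in> S \<inter> {c..d}. s < r} \<le> r" by simp
    qed
    show "Inf {r \<in> S. s < r} \<le> Inf {r \<in> S \<inter> {c..d}. s < r}"
      using ne(1) by (intro cInf_superset_mono bdd_belowI[where m = s]) auto
  qed
  then show ?thesis unfolding fwd_jump_def if_not_P[OF ne(1)] if_not_P[OF ne(2)] .
qed

lemma delta_derivative_restrict:
  assumes "s \<in> S" "c \<le> s" "s < d" "has_delta_derivative S f D s"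
  shows "has_delta_derivative (S \<inter> {c..d}) f D s"
  using assms(4) unfolding has_delta_derivative_def fwd_jump_restrict[OF assms(1-3)]
  by (meson IntD1)

text \<open>Any two witnessing antiderivatives can be compared, so no regularity of the integrands
  is needed. Used in both directions, it also shows that an integral has only one value.\<close>

lemma has_delta_integral_mono:
  assumes "has_delta_integral S f c d I" "has_delta_integral S g c d J"
    and "\<And>s. s \<in> S \<Longrightarrow> c \<le> s \<Longrightarrow> s < d \<Longrightarrow> f s \<le> g s"
  shows "I \<le> J"
proof -
  interpret R: compact_time_scale "S \<inter> {c..d}" c d by (rule restrict)
  from assms obtain F G where
    "continuous_on (S \<inter> {c..d}) F" "\<forall>s\<in>S \<inter> {c..<d}. has_delta_derivative (S \<inter> {c..d}) F (f s) s"
    "continuous_on (S \<inter> {c..d}) G" "\<forall>s\<in>S \<inter> {c..<d}. has_delta_derivative (S \<inter> {c..d}) G (g s) s"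
    "I = F d - F c" "J = G d - G c"
    by (auto simp: has_delta_integral_def)
  then show ?thesis using assms(3) by (auto intro!: R.delta_derivative_mono)
qed

lemma delta_integral_eq:
  assumes "has_delta_integral S f c d I" shows "delta_integral S c d f = I"
  unfolding delta_integral_def
proof (rule the_equality)
  show "has_delta_integral S f c d I" by fact
  show "J = I" if "has_delta_integral S f c d J" for J
    using has_delta_integral_mono[OF that assms] has_delta_integral_mono[OF assms that] by simp
qed

lemma has_delta_integral_primitive:
  assumes "continuous_on S G"
    and "\<And>s. s \<in> S \<Longrightarrow> c \<le> s \<Longrightarrow> s < d \<Longrightarrow> has_delta_derivative S G (f s) s"
  shows "has_delta_integral S f c d (G d - G c)"
  unfolding has_delta_integral_def using assms
  by (intro exI[of _ G]) (auto intro!: delta_derivative_restrict continuous_on_subset[OF assms(1)])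

text \<open>The derivatives are integrable simply because \<open>f\<close> and \<open>g\<close> are
  their primitives; a pointwise inequality before \<open>d\<close> is all that is asked of
  them.\<close>

lemma delta_derivative_increment_le:
  assumes "continuous_on S f" "continuous_on S g"
    and "\<And>s. s \<in> S \<Longrightarrow> c \<le> s \<Longrightarrow> s < d \<Longrightarrow> has_delta_derivative S f (f' s) s"
    and "\<And>s. s \<in> S \<Longrightarrow> c \<le> s \<Longrightarrow> s < d \<Longrightarrow> has_delta_derivative S g (g' s) s"
    and "\<And>s. s \<in> S \<Longrightarrow> c \<le> s \<Longrightarrow> s < d \<Longrightarrow> f' s \<le> g' s"
  shows "f d - f c \<le> g d - g c"
  by (rule has_delta_integral_mono[OF has_delta_integral_primitive[of f f']
        has_delta_integral_primitive[of g g']]) (use assms in auto)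

lemma dini_nonneg_imp_le_restrict:
  assumes "continuous_on S f"
    and "\<And>s e. s \<in> S \<Longrightarrow> c \<le> s \<Longrightarrow> s < d \<Longrightarrow> 0 < e \<Longrightarrow>
      \<exists>\<delta>>0. \<forall>r\<in>S. s < r \<longrightarrow> r < s + \<delta> \<or> r = \<sigma> s \<longrightarrow> f s - e * (r - s) \<le> f r"
  shows "f c \<le> f d"
proof -
  interpret R: compact_time_scale "S \<inter> {c..d}" c d by (rule restrict)
  show ?thesis
  proof (rule R.dini_nonneg_imp_le)
    show "continuous_on (S \<inter> {c..d}) f" using assms(1) by (rule continuous_on_subset) auto
    fix s e :: real assume "s \<in> S \<inter> {c..d}" "s < d" "0 < e"
    then show "\<exists>\<delta>>0. \<forall>r\<in>S \<inter> {c..d}. s < r \<longrightarrow> r < s + \<delta> \<or> r = R.\<sigma> s \<longrightarrow>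
        f s - e * (r - s) \<le> f r"
      using assms(2)[of s e] fwd_jump_restrict[of s] by (metis IntD1 IntD2 atLeastAtMost_iff)
  qed
qed

end

subsection \<open>Delta antiderivatives of rd-continuous functions\<close>

text \<open>On each side there is either a limit or, at a scattered side, no point nearby. The bound
  is for the punctured neighbourhood, as \<open>f t\<close> may differ from the left limit.\<close>

lemma rd_locally_bounded:
  assumes rd: "rd_continuous_on S S f" and t: "t \<in> S"
  shows "\<exists>B. \<forall>\<^sub>F s in at t within S. \<bar>f s\<bar> \<le> B"
proof -
  have "\<exists>B. \<forall>\<^sub>F s in at t within (S \<inter> {..<t}). \<bar>f s\<bar> \<le> B"
  proof (cases "bwd_jump S t = t")
    case True
    with rd t obtain l where "(f \<longlongrightarrow> l) (at t within (S \<inter> {..<t}))"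
      by (auto simp: rd_continuous_on_def)
    from tendstoD[OF this zero_less_one] show ?thesis
      by (intro exI[of _ "\<bar>l\<bar> + 1"]) (auto elim!: eventually_mono simp: dist_real_def)
  next
    case False
    with bwd_jump_le[OF t] have "bwd_jump S t < t" by simp
    then have "\<forall>\<^sub>F s in at t within (S \<inter> {..<t}). False"
      using bwd_jump_ge[OF t] unfolding eventually_at
      by (intro exI[of _ "t - bwd_jump S t"]) (force simp: dist_real_def)
    then show ?thesis by (auto elim!: eventually_mono)
  qed
  then obtain B where B: "\<forall>\<^sub>F s in at t within (S \<inter> {..<t}). \<bar>f s\<bar> \<le> B" ..
  have "\<exists>B. \<forall>\<^sub>F s in at t within (S \<inter> {t<..}). \<bar>f s\<bar> \<le> B"
  proof (cases t rule: right_cases)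
    case dense
    with rd t have "(f \<longlongrightarrow> f t) (at t within S)"
      by (auto simp: rd_continuous_on_def continuous_within)
    then have "(f \<longlongrightarrow> f t) (at t within (S \<inter> {t<..}))"
      by (rule tendsto_within_subset) auto
    from tendstoD[OF this zero_less_one] show ?thesis
      by (intro exI[of _ "\<bar>f t\<bar> + 1"]) (auto elim!: eventually_mono simp: dist_real_def)
  next
    case scattered
    then have "\<forall>\<^sub>F s in at t within (S \<inter> {t<..}). False"
      using fwd_jump_le[of _ t] unfolding eventually_at
      by (intro exI[of _ "\<sigma> t - t"]) (force simp: dist_real_def)
    then show ?thesis by (auto elim!: eventually_mono)
  qed
  then obtain B' where B': "\<forall>\<^sub>F s in at t within (S \<inter> {t<..}). \<bar>f s\<bar> \<le> B'" ..
  have "\<forall>\<^sub>F s in at t within (S \<inter> {..<t} \<union> S \<inter> {t<..}). \<bar>f s\<bar> \<le> max B B'"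
    using B B' unfolding at_within_union eventually_sup
    by (auto elim!: eventually_mono)
  moreover have "at t within (S \<inter> {..<t} \<union> S \<inter> {t<..}) = at t within S"
    by (rule at_within_nhd[of t UNIV]) auto
  ultimately show ?thesis by auto
qed

text \<open>Compactness glues the local bounds. The result makes the extension of \<open>f\<close>
  to the line integrable.\<close>

lemma rd_bounded:
  assumes rd: "rd_continuous_on S S f"
  obtains B where "\<And>s. s \<in> S \<Longrightarrow> \<bar>f s\<bar> \<le> B"
proof -
  have "\<exists>U B. open U \<and> t \<in> U \<and> (\<forall>s\<in>S \<inter> U. \<bar>f s\<bar> \<le> B)" if t: "t \<in> S" for t
  proof -
    from rd_locally_bounded[OF rd t] obtain B where
      "\<forall>\<^sub>F s in at t within S. \<bar>f s\<bar> \<le> B" ..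
    then obtain U where "open U" "t \<in> U" "\<And>s. s \<in> U \<Longrightarrow> s \<noteq> t \<Longrightarrow> s \<in> S \<Longrightarrow> \<bar>f s\<bar> \<le> B"
      unfolding eventually_at_topological by blast
    then show ?thesis
      by (intro exI[of _ U] exI[of _ "max B \<bar>f t\<bar>"]) (force simp: le_max_iff_disj)
  qed
  then obtain U B where U: "\<And>t. t \<in> S \<Longrightarrow> open (U t) \<and> t \<in> U t \<and> (\<forall>s\<in>S \<inter> U t. \<bar>f s\<bar> \<le> B t)"
    by metis
  obtain C where C: "C \<subseteq> S" "finite C" "S \<subseteq> (\<Union>t\<in>C. U t)"
    using compactE_image[OF compact, of S U] U by blast
  show thesis
  proof (rule that)
    fix s assume s: "s \<in> S"
    with C obtain t where t: "t \<in> C" "s \<in> U t" by blast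
    then have "\<bar>f s\<bar> \<le> B t" using U s C(1) by blast
    also have "\<dots> \<le> Max (B ` C)" using C(2) t(1) by simp
    finally show "\<bar>f s\<bar> \<le> Max (B ` C)" .
  qed
qed

text \<open>\<open>floor_pt\<close> retracts the line onto the time scale. Integrating \<open>f \<circ> floor_pt\<close> over a gap
  \<open>[t, \<sigma> t]\<close> gives \<open>f t\<close> times its length, so the Lebesgue integral of this extension is a
  delta antiderivative of \<open>f\<close>.\<close>
definition floor_pt :: "real \<Rightarrow> real" where
  "floor_pt x = Sup {s \<in> S. s \<le> max a x}"

lemma floor_pt_bounds:
  shows floor_pt_mem: "floor_pt x \<in> S" and floor_pt_le: "floor_pt x \<le> max a x"
    and floor_pt_ge: "\<And>s. s \<in> S \<Longrightarrow> s \<le> max a x \<Longrightarrow> s \<le> floor_pt x"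
proof -
  \<comment> \<open>The cut at \<open>max a x\<close> keeps \<open>a\<close> in the set even for
    \<open>x < a\<close>.\<close>
  have ne: "{s \<in> S. s \<le> max a x} \<noteq> {}" using min_in by auto
  have bdd: "bdd_above {s \<in> S. s \<le> max a x}" by (auto intro!: bdd_aboveI[where M = "max a x"])
  have "floor_pt x \<in> closure {s \<in> S. s \<le> max a x}" unfolding floor_pt_def
    by (rule closure_contains_Sup[OF ne bdd])
  also have "\<dots> \<subseteq> S" using closed by (intro closure_minimal) auto
  finally show "floor_pt x \<in> S" .
  show "floor_pt x \<le> max a x" unfolding floor_pt_def using ne by (intro cSup_least) auto
  show "s \<le> floor_pt x" if "s \<in> S" "s \<le> max a x" for s
    unfolding floor_pt_def using that bdd by (intro cSup_upper) auto
qed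

lemma floor_pt_eq:
  assumes "t \<in> S" "t \<le> x" "\<And>s. s \<in> S \<Longrightarrow> t < s \<Longrightarrow> x < s"
  shows "floor_pt x = t"
proof -
  have ax: "max a x = x" using assms in_bounds(1)[of t] by auto
  have "t \<le> floor_pt x" using floor_pt_ge[of t x] assms ax by simp
  moreover have "\<not> t < floor_pt x"
    using assms(3)[OF floor_pt_mem, of x] floor_pt_le[of x] ax by auto
  ultimately show ?thesis by simp
qed

lemma floor_pt_id: "t \<in> S \<Longrightarrow> floor_pt t = t"
  by (rule floor_pt_eq) auto

text \<open>Either \<open>S\<close> has no points just right of \<open>x\<close>, and
  \<open>floor_pt\<close> is constant there, or \<open>x\<close> is a right-dense point of
  \<open>S\<close>, where \<open>f\<close> is continuous. From the left nothing similar holds: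
  \<open>floor_pt\<close> jumps at the end of a gap.\<close>

lemma floor_pt_right_continuous:
  assumes rd: "rd_continuous_on S S f"
  shows "((\<lambda>x. f (floor_pt x)) \<longlongrightarrow> f (floor_pt x)) (at_right x)"
proof (cases "\<exists>d>0. \<forall>s\<in>S. x < s \<longrightarrow> x + d \<le> s")
  case True
  then obtain d where d: "d > 0" "\<And>s. s \<in> S \<Longrightarrow> x < s \<Longrightarrow> x + d \<le> s" by auto
  have "floor_pt y = floor_pt x" if "x < y" "y < x + d" for y
  proof -
    have "s \<le> max a y \<longleftrightarrow> s \<le> max a x" if "s \<in> S" for s
      using d(2)[OF that] d(2)[OF min_in] in_bounds(1)[OF that] \<open>x < y\<close> \<open>y < x + d\<close> by force
    then show ?thesis unfolding floor_pt_def by (metis (mono_tags, lifting) Collect_cong)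
  qed
  then have "\<forall>\<^sub>F y in at_right x. f (floor_pt y) = f (floor_pt x)"
    using d(1) unfolding eventually_at_right_field by (intro exI[of _ "x + d"]) auto
  then show ?thesis by (rule tendsto_eventually)
next
  case False
  then have dense: "\<exists>s\<in>S. x < s \<and> s < x + d" if "d > 0" for d using that by force
  have "\<exists>s\<in>S. dist s x < d" if "d > 0" for d
    using dense[OF that] by (force simp: dist_real_def)
  then have "x \<in> closure S" unfolding closure_approachable by blast
  then have x: "x \<in> S" using closed by simp
  have "\<sigma> x = x"
  proof (rule ccontr)
    assume "\<sigma> x \<noteq> x"
    then have "\<sigma> x - x > 0" using fwd_jump_ge[of x] by simp
    from dense[OF this] fwd_jump_le[of _ x] show False by force
  qed
  with rd x have lim: "(f \<longlongrightarrow> f x) (at x within S)"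
    by (auto simp: rd_continuous_on_def continuous_within)
  show ?thesis unfolding floor_pt_id[OF x]
  proof (rule tendstoI)
    fix e :: real assume "e > 0"
    from tendstoD[OF lim this] obtain d where "d > 0"
      and d: "\<And>s. s \<in> S \<Longrightarrow> s \<noteq> x \<Longrightarrow> dist s x < d \<Longrightarrow> dist (f s) (f x) < e"
      unfolding eventually_at by blast
    have "dist (f (floor_pt y)) (f x) < e" if "x < y" "y < x + d" for y
    proof -
      have "x \<le> floor_pt y" using floor_pt_ge[OF x, of y] that by simp
      moreover have "floor_pt y \<le> y" using floor_pt_le[of y] in_bounds(1)[OF x] that by simp
      ultimately show ?thesis
        using d[OF floor_pt_mem, of y] that \<open>e > 0\<close> by (cases "floor_pt y = x") (auto simp: dist_real_def)
    qed
    then show "\<forall>\<^sub>F y in at_right x. dist (f (floor_pt y)) (f x) < e"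
      using \<open>d > 0\<close> unfolding eventually_at_right_field by (intro exI[of _ "x + d"]) auto
  qed
qed

text \<open>The extension is measurable, being right-continuous, and bounded, hence integrable.
  Since \<open>\<sigma> b = b\<close>, the point \<open>b\<close> falls under the dense case, so the
  derivative is obtained there as well.\<close>

lemma rd_continuous_primitive:
  assumes rd: "rd_continuous_on S S f"
  obtains G where "continuous_on S G" "G a = 0" "\<And>s. s \<in> S \<Longrightarrow> has_delta_derivative S G (f s) s"
proof -
  define g where "g x = f (floor_pt x)" for x
  define G where "G x = integral {a..x} g" for x
  obtain B where B: "\<And>s. s \<in> S \<Longrightarrow> \<bar>f s\<bar> \<le> B" using rd_bounded[OF rd] by blast
  have "g \<in> borel_measurable borel"
    unfolding g_def
    by (rule right_continuous_imp_borel_measurable) (rule floor_pt_right_continuous[OF rd])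
  then have "g \<in> borel_measurable (lebesgue_on {a..b})"
    by (intro measurable_restrict_space1 measurable_completion) simp
  then have int: "g integrable_on {a..b}"
    by (rule measurable_bounded_by_integrable_imp_integrable[where g = "\<lambda>_. B"])
       (auto simp: g_def intro: B floor_pt_mem)
  have cont: "continuous_on S G"
    unfolding G_def
    by (rule continuous_on_subset[OF indefinite_integral_continuous_1[OF int] bounds])
  have int': "g integrable_on {r..s}" if "r \<in> S" "s \<in> S" for r s
    by (rule integrable_on_subinterval[OF int]) (use in_bounds that in auto)
  have diff: "(g has_integral (G s - G r)) {r..s}" if "r \<in> S" "s \<in> S" "r \<le> s" for r s
  proof -
    have "integral {a..r} g + integral {r..s} g = integral {a..s} g"
      by (rule Henstock_Kurzweil_Integration.integral_combine)
         (use that in_bounds int'[OF min_in that(2)] in auto)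
    then show ?thesis using int'[OF that(1,2)] by (simp add: G_def has_integral_iff)
  qed
  have "has_delta_derivative S G (f t) t" if t: "t \<in> S" for t
  proof (cases t rule: right_cases)
    case scattered
    have "(g has_integral f t * (\<sigma> t - t)) {t..\<sigma> t}"
    \<comment> \<open>\<open>floor_pt\<close> equals \<open>t\<close> on the gap except at its right
      end, a single point.\<close>
    proof (rule has_integral_spike_finite[of "{\<sigma> t}"])
      show "((\<lambda>_. f t) has_integral f t * (\<sigma> t - t)) {t..\<sigma> t}"
        using has_integral_const_real[of "f t" t "\<sigma> t"] scattered by (simp add: mult.commute)
      fix x assume "x \<in> {t..\<sigma> t} - {\<sigma> t}"
      then have "floor_pt x = t"
        using fwd_jump_le[of _ t] by (intro floor_pt_eq[OF t]) force+
      then show "g x = f t" by (simp add: g_def)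
    qed auto
    from has_integral_unique[OF diff[OF t fwd_jump_mem[OF t] fwd_jump_ge] this]
    show ?thesis using scattered t cont
      by (simp add: delta_derivative_right_scattered continuous_on_eq_continuous_within)
  next
    case dense
    with rd t have fc: "continuous (at t within S) f" by (auto simp: rd_continuous_on_def)
    show ?thesis unfolding has_delta_derivative_def dense
    proof (intro allI impI)
      fix e :: real assume e: "e > 0"
      with fc obtain d where d: "d > 0" "\<And>s. s \<in> S \<Longrightarrow> dist s t < d \<Longrightarrow> dist (f s) (f t) < e"
        unfolding continuous_within_eps_delta by metis
      have bnd: "\<bar>(G s - G r) - f t * (s - r)\<bar> \<le> e * (s - r)"
        if rs: "r \<in> S" "s \<in> S" "r \<le> s" "\<bar>r - t\<bar> < d" "\<bar>s - t\<bar> < d" for r s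
      proof -
        have "((\<lambda>x. g x - f t) has_integral (G s - G r) - f t * (s - r)) {r..s}"
          using has_integral_diff[OF diff[OF rs(1-3)] has_integral_const_real[of "f t" r s]] rs(3)
          by (simp add: mult.commute)
        moreover have "norm (g x - f t) \<le> e" if x: "x \<in> {r..s}" for x
        proof -
          have "a \<le> x" using x in_bounds(1)[OF rs(1)] by simp
          \<comment> \<open>As \<open>r\<close> and \<open>s\<close> belong to \<open>S\<close>,
            \<open>floor_pt\<close> maps \<open>{r..s}\<close> into itself, and \<open>g\<close>
            only takes values of \<open>f\<close> near \<open>t\<close>.\<close>
          then have "r \<le> floor_pt x" "floor_pt x \<le> s"
            using floor_pt_ge[OF rs(1), of x] floor_pt_le[of x] x by auto
          then show ?thesis using d(2)[OF floor_pt_mem, of x] rs(4,5)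
            unfolding g_def dist_real_def real_norm_def by fastforce
        qed
        ultimately have "norm ((G s - G r) - f t * (s - r)) \<le> e * measure lborel (cbox r s)"
          using e by (intro has_integral_bound[of e "\<lambda>x. g x - f t"]) auto
        then show ?thesis using rs(3) by simp
      qed
      show "\<exists>d>0. \<forall>s\<in>S. \<bar>s - t\<bar> < d \<longrightarrow> \<bar>G t - G s - f t * (t - s)\<bar> \<le> e * \<bar>t - s\<bar>"
      proof (intro exI[of _ d] conjI ballI impI)
        fix s assume s: "s \<in> S" "\<bar>s - t\<bar> < d"
        show "\<bar>G t - G s - f t * (t - s)\<bar> \<le> e * \<bar>t - s\<bar>"
        proof (cases "s \<le> t")
          case True then show ?thesis using bnd[OF s(1) t True] s(2) d(1) by simp
        next
          case False
          have "G t - G s - f t * (t - s) = - (G s - G t - f t * (s - t))"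
            by (simp add: algebra_simps)
          then show ?thesis using bnd[OF t s(1)] s(2) d(1) False by simp
        qed
      qed fact
    qed
  qed
  moreover have "G a = 0" by (simp add: G_def)
  ultimately show thesis using that cont by blast
qed

section \<open>The role of the maximum, and stability of rd-continuity\<close>

lemma kappa_eq: "t \<in> ts_kappa S \<longleftrightarrow> t \<in> S \<and> (t = b \<longrightarrow> bwd_jump S b = b)"
proof -
  have "(\<forall>s\<in>S. s \<le> t) \<longleftrightarrow> t = b" if "t \<in> S"
    using that max_in in_bounds by (auto intro: antisym)
  then show ?thesis using bwd_jump_le[OF max_in] by (auto simp: ts_kappa_def max_in)
qed

lemma at_max_isolated:
  assumes "bwd_jump S b < b" shows "at b within S = bot"
proof -
  have "\<forall>\<^sub>F s in at b within S. False"
    using assms bwd_jump_ge[OF max_in] in_bounds(2) unfolding eventually_at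
    by (intro exI[of _ "b - bwd_jump S b"]) (force simp: dist_real_def)
  then show ?thesis by (simp add: trivial_limit_def)
qed

lemma delta_differentiable_imp_continuous_on:
  assumes "\<And>s. s \<in> ts_kappa S \<Longrightarrow> has_delta_derivative S f (f' s) s"
  shows "continuous_on S f"
  unfolding continuous_on_eq_continuous_within
proof
  fix s assume s: "s \<in> S"
  show "continuous (at s within S) f"
  proof (cases "s \<in> ts_kappa S")
    case True
    then show ?thesis using assms delta_derivative_imp_continuous s by blast
  next
    case False
    then have "s = b" "bwd_jump S b < b" using s bwd_jump_le[OF max_in] by (auto simp: kappa_eq)
    then show ?thesis by (simp add: at_max_isolated)
  qed
qed

text \<open>When \<open>b\<close> is removed it is isolated: neighbourhoods of the other points are
  unaffected, and any value of \<open>f\<close> at \<open>b\<close> is admissible.\<close>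

lemma rd_continuous_on_kappa:
  assumes "rd_continuous_on S (ts_kappa S) f" shows "rd_continuous_on S S f"
proof (cases "bwd_jump S b = b")
  case True
  then have "ts_kappa S = S" by (auto simp: kappa_eq)
  with assms show ?thesis by simp
next
  case False
  with bwd_jump_le[OF max_in] have iso: "bwd_jump S b < b" by simp
  have k: "ts_kappa S = S - {b}" using False kappa_eq by blast
  have "at t within (S - {b}) = at t within S" if "t \<in> S" "t \<noteq> b" for t
    by (rule at_within_nhd[of t "- {b}"]) (use that in auto)
  note within = this
  have left: "(S - {b}) \<inter> {..<t} = S \<inter> {..<t}" if "t \<in> S" for t
    using in_bounds(2)[OF that] by auto
  show ?thesis
    unfolding rd_continuous_on_def
  proof (intro ballI conjI impI)
    fix t assume t: "t \<in> S"
    show "continuous (at t within S) f" if "\<sigma> t = t"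
    proof (cases "t = b")
      case True then show ?thesis by (simp add: at_max_isolated[OF iso])
    next
      case False
      then show ?thesis using assms t that within[OF t False]
        by (auto simp: rd_continuous_on_def k continuous_within)
    qed
    show "\<exists>l. (f \<longlongrightarrow> l) (at t within S \<inter> {..<t})" if "bwd_jump S t = t"
    proof -
      have "t \<in> ts_kappa S" using t that False kappa_eq by blast
      then have "\<exists>l. (f \<longlongrightarrow> l) (at t within ts_kappa S \<inter> {..<t})"
        using assms that unfolding rd_continuous_on_def by blast
      then show ?thesis unfolding k left[OF t] .
    qed
  qed
qed

lemma continuous_imp_rd_continuous:
  assumes "continuous_on S f" shows "rd_continuous_on S S f"
  using assms unfolding rd_continuous_on_def continuous_on_eq_continuous_within continuous_within
  by (meson inf_le1 tendsto_within_subset)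

lemma rd_continuous_add:
  assumes "rd_continuous_on S S f" "rd_continuous_on S S g"
  shows "rd_continuous_on S S (\<lambda>s. f s + g s)"
  using assms unfolding rd_continuous_on_def by (blast intro: continuous_add tendsto_add)

lemma rd_continuous_mult:
  assumes "rd_continuous_on S S f" "rd_continuous_on S S g"
  shows "rd_continuous_on S S (\<lambda>s. f s * g s)"
  using assms unfolding rd_continuous_on_def by (blast intro: continuous_mult tendsto_mult)

lemma delta_derivative_cong:
  assumes "\<And>s. s \<in> S \<Longrightarrow> f s = g s" "t \<in> S"
  shows "has_delta_derivative S f D t \<longleftrightarrow> has_delta_derivative S g D t"
  using assms fwd_jump_mem[OF assms(2)] by (simp add: has_delta_derivative_def)

lemma delta_integral_cong:
  assumes "\<And>s. s \<in> S \<Longrightarrow> s < d \<Longrightarrow> f s = g s"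
  shows "delta_integral S c d f = delta_integral S c d g"
  unfolding delta_integral_def has_delta_integral_def using assms by simp

text \<open>On \<open>S\<close> the integral coincides with the primitive that vanishes at
  \<open>a\<close>, and the properties transfer by congruence on \<open>S\<close>.\<close>

lemma rd_continuous_delta_integral:
  assumes "rd_continuous_on S S f"
  shows delta_integral_continuous: "continuous_on S (\<lambda>t. delta_integral S a t f)"
    and delta_integral_min: "delta_integral S a a f = 0"
    and delta_integral_derivative:
      "\<And>s. s \<in> S \<Longrightarrow> has_delta_derivative S (\<lambda>t. delta_integral S a t f) (f s) s"
    and has_delta_integral_rd:
      "\<And>d. d \<in> S \<Longrightarrow> has_delta_integral S f a d (delta_integral S a d f)"
proof -
  obtain G where G: "continuous_on S G" "G a = 0" "\<And>s. s \<in> S \<Longrightarrow> has_delta_derivative S G (f s) s"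
    using rd_continuous_primitive[OF assms] by blast
  have has: "has_delta_integral S f a d (G d)" if "d \<in> S" for d
    using has_delta_integral_primitive[OF min_in that _ G(1,3)] in_bounds that G(2) by simp
  have eq: "delta_integral S a d f = G d" if "d \<in> S" for d
    using delta_integral_eq[OF min_in that _ has[OF that]] in_bounds that by simp
  show "continuous_on S (\<lambda>t. delta_integral S a t f)"
    using G(1) by (simp cong: continuous_on_cong add: eq)
  show "delta_integral S a a f = 0" using eq[OF min_in] G(2) by simp
  show "has_delta_derivative S (\<lambda>t. delta_integral S a t f) (f s) s" if "s \<in> S" for s
    using delta_derivative_cong[OF eq that] G(3)[OF that] by simp
  show "has_delta_integral S f a d (delta_integral S a d f)" if "d \<in> S" for d
    using has eq that by simp
qed

lemma delta_integral_increasing: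
  assumes "rd_continuous_on S S f" "r \<in> S" "s \<in> S" "r \<le> s"
    and "\<And>x. x \<in> S \<Longrightarrow> x < s \<Longrightarrow> 0 \<le> f x"
  shows "delta_integral S a r f \<le> delta_integral S a s f"
proof -
  have "0 - 0 \<le> delta_integral S a s f - delta_integral S a r f"
    by (rule delta_derivative_increment_le[OF assms(2-4), of "\<lambda>_. 0" _ "\<lambda>_. 0" f])
       (use assms in \<open>auto intro: delta_derivative_const delta_integral_continuous
          delta_integral_derivative\<close>)
  then show ?thesis by simp
qed

lemma delta_integral_nonneg:
  assumes "rd_continuous_on S S f" "s \<in> S" "\<And>x. x \<in> S \<Longrightarrow> x < s \<Longrightarrow> 0 \<le> f x"
  shows "0 \<le> delta_integral S a s f"
  using delta_integral_increasing[OF assms(1) min_in assms(2)] assms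
  by (simp add: delta_integral_min in_bounds)

lemma delta_integral_mono:
  assumes "rd_continuous_on S S f" "rd_continuous_on S S g" "t \<in> S"
    and "\<And>s. s \<in> S \<Longrightarrow> s < t \<Longrightarrow> f s \<le> g s"
  shows "delta_integral S a t f \<le> delta_integral S a t g"
  by (rule has_delta_integral_mono[OF min_in assms(3) _ has_delta_integral_rd[OF assms(1,3)]
        has_delta_integral_rd[OF assms(2,3)]]) (use assms in_bounds in auto)

lemma delta_derivative_zero_imp_const:
  assumes "continuous_on S f" "t \<in> S"
    and "\<And>s. s \<in> S \<Longrightarrow> s < b \<Longrightarrow> has_delta_derivative S f 0 s"
  shows "f t = f a"
proof -
  have at: "a \<le> t" "t \<le> b" using in_bounds assms(2) by auto
  have "f t - f a \<le> f a - f a"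
    by (rule delta_derivative_increment_le[OF min_in assms(2) at(1), of f "\<lambda>_. f a" "\<lambda>_. 0" "\<lambda>_. 0"])
       (use assms at in \<open>auto intro: delta_derivative_const\<close>)
  moreover have "f a - f a \<le> f t - f a"
    by (rule delta_derivative_increment_le[OF min_in assms(2) at(1), of "\<lambda>_. f a" f "\<lambda>_. 0" "\<lambda>_. 0"])
       (use assms at in \<open>auto intro: delta_derivative_const\<close>)
  ultimately show ?thesis by simp
qed

subsection \<open>The exponential function and two integral inequalities\<close>

text \<open>From the left, \<open>\<sigma> s \<le> t\<close>. From the right, a point
  \<open>r\<close> of \<open>S\<close> slightly beyond \<open>t\<close> caps
  \<open>\<sigma> s\<close> for all \<open>s < r\<close>.\<close>

lemma graininess_tendsto_0:
  assumes t: "t \<in> S" and dense: "\<sigma> t = t"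
  shows "((\<lambda>s. \<sigma> s - s) \<longlongrightarrow> 0) (at t within S)"
proof (rule tendstoI)
  fix e :: real assume e: "e > 0"
  \<comment> \<open>For \<open>t = b\<close> no point lies to the right, and \<open>r\<close> only
    serves as a radius.\<close>
  have "\<exists>r>t. r < t + e \<and> (r \<in> S \<or> t = b)"
  proof (cases "t = b")
    case True
    then show ?thesis using e by (intro exI[of _ "t + e / 2"]) auto
  next
    case False
    then have "t < b" using in_bounds t by force
    from right_dense_point[OF dense this e] show ?thesis by metis
  qed
  then obtain r where r: "t < r" "r < t + e" "r \<in> S \<or> t = b" by auto
  show "\<forall>\<^sub>F s in at t within S. dist (\<sigma> s - s) 0 < e"
    unfolding eventually_at
  proof (intro exI[of _ "r - t"] conjI ballI impI)
    fix s assume s: "s \<in> S" "s \<noteq> t \<and> dist s t < r - t"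
    show "dist (\<sigma> s - s) 0 < e"
    proof (cases "s < t")
      case True
      then show ?thesis using fwd_jump_le[OF t True] fwd_jump_ge[of s] s r by (auto simp: dist_real_def)
    next
      case False
      with s have "t < s" "s < r" by (auto simp: dist_real_def)
      moreover from this have "r \<in> S" using r in_bounds(2)[OF s(1)] by auto
      ultimately show ?thesis using fwd_jump_le[of r s] fwd_jump_ge[of s] r by (auto simp: dist_real_def)
    qed
  qed (use r in simp)
qed

lemma graininess_left_tendsto_0:
  assumes t: "t \<in> S"
  shows "((\<lambda>s. \<sigma> s - s) \<longlongrightarrow> 0) (at t within (S \<inter> {..<t}))"
proof (rule tendstoI)
  fix e :: real assume e: "e > 0"
  show "\<forall>\<^sub>F s in at t within (S \<inter> {..<t}). dist (\<sigma> s - s) 0 < e"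
    unfolding eventually_at
  proof (intro exI[of _ e] conjI ballI impI)
    fix s assume "s \<in> S \<inter> {..<t}" "s \<noteq> t \<and> dist s t < e"
    then show "dist (\<sigma> s - s) 0 < e"
      using fwd_jump_le[OF t, of s] fwd_jump_ge[of s] by (auto simp: dist_real_def)
  qed fact
qed

text \<open>The exponential is \<open>exp\<close> of the delta integral of \<open>ln (1 + \<mu>) / \<mu>\<close>, \<open>\<mu>\<close> being the graininess.\<close>
lemma exponential_exists:
  obtains E where "E a = 1" "\<And>s. s \<in> S \<Longrightarrow> has_delta_derivative S E (E s) s"
    "\<And>s. s \<in> S \<Longrightarrow> 1 \<le> E s"
proof -
  define q :: "real \<Rightarrow> real" where "q x = (if x = 0 then 1 else ln (1 + x) / x)" for x
  define k where "k s = q (\<sigma> s - s)" for s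
  have cont: "isCont q 0" unfolding q_def by (rule isCont_ln_quotient)
  have rd: "rd_continuous_on S S k"
    unfolding rd_continuous_on_def continuous_within k_def
    using isCont_tendsto_compose[OF cont graininess_tendsto_0]
      isCont_tendsto_compose[OF cont graininess_left_tendsto_0] by auto
  obtain L where L: "continuous_on S L" "L a = 0" "\<And>s. s \<in> S \<Longrightarrow> has_delta_derivative S L (k s) s"
    using rd_continuous_primitive[OF rd] by blast
  show thesis
  proof (rule that[of "\<lambda>t. exp (L t)"])
    show "exp (L a) = 1" using L by simp
    show "has_delta_derivative S (\<lambda>t. exp (L t)) (exp (L s)) s" if s: "s \<in> S" for s
    proof (cases s rule: right_cases)
      case dense
      with L(3)[OF s] show ?thesis
        by (auto simp: delta_derivative_right_dense k_def q_def intro!: derivative_eq_intros)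
    next
      case scattered
      with L(3)[OF s] s have cL: "continuous (at s within S) L"
        and "L (\<sigma> s) - L s = k s * (\<sigma> s - s)"
        by (auto simp: delta_derivative_right_scattered)
      \<comment> \<open>The factor \<open>1 / \<mu>\<close> in the integrand cancels the length of
        the gap, so \<open>exp\<close> of \<open>L\<close> is multiplied by exactly
        \<open>1 + \<mu>\<close>, with \<open>\<mu> = \<sigma> s - s\<close>.\<close>
      then have "L (\<sigma> s) = L s + ln (1 + (\<sigma> s - s))"
        using scattered by (simp add: k_def q_def)
      then have "exp (L (\<sigma> s)) = exp (L s) * (1 + (\<sigma> s - s))"
        using scattered by (simp add: exp_add)
      then show ?thesis using s scattered cL
        by (simp add: delta_derivative_right_scattered algebra_simps continuous_intros)
    qed
    show "1 \<le> exp (L s)" if s: "s \<in> S" for s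
    proof -
      have "0 \<le> k x" for x using fwd_jump_ge[of x] by (auto simp: k_def q_def)
      then have "0 - 0 \<le> L s - L a"
        using L s in_bounds min_in
        by (intro delta_derivative_increment_le[OF min_in s, of "\<lambda>_. 0" _ "\<lambda>_. 0" k])
           (auto intro: delta_derivative_const)
      then show ?thesis using L(2) by simp
    qed
  qed
qed

abbreviation e1 :: "real \<Rightarrow> real" where "e1 t \<equiv> ts_exp S (\<lambda>_. 1) t a"

text \<open>The quotient of any solution by the constructed \<open>E\<close> has derivative 0, hence
  is constant. This makes the description in \<open>ts_exp\<close> well defined and yields the
  quotient formula for an arbitrary base point.\<close>

lemma exponential:
  shows e1_min: "e1 a = 1"
    and e1_derivative: "\<And>s. s \<in> S \<Longrightarrow> has_delta_derivative S e1 (e1 s) s"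
    and e1_ge_1: "\<And>s. s \<in> S \<Longrightarrow> 1 \<le> e1 s"
    and e1_continuous: "continuous_on S e1"
    and ts_exp_1: "\<And>s t. s \<in> S \<Longrightarrow> t \<in> S \<Longrightarrow> ts_exp S (\<lambda>_. 1) t s = e1 t / e1 s"
proof -
  obtain E where E: "E a = 1" "\<And>s. s \<in> S \<Longrightarrow> has_delta_derivative S E (E s) s"
    "\<And>s. s \<in> S \<Longrightarrow> 1 \<le> E s" using exponential_exists by blast
  have pos: "E s > 0" if "s \<in> S" for s using E(3)[OF that] by simp
  have cE: "continuous_on S E"
    unfolding continuous_on_eq_continuous_within using E(2) delta_derivative_imp_continuous by blast
  have eq: "ts_exp S (\<lambda>_. 1) t s = E t / E s" if s: "s \<in> S" and t: "t \<in> S" for s t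
    unfolding ts_exp_def
  proof (rule the_equality)
    have "has_delta_derivative S (\<lambda>t. E t / E s) (1 * (E r / E s)) r" if "r \<in> S" for r
      using delta_derivative_cmult[OF that E(2)[OF that], of "1 / E s"] by simp
    then show "\<exists>y. (\<forall>r\<in>ts_kappa S. has_delta_derivative S y (1 * y r) r) \<and> y s = 1 \<and> E t / E s = y t"
      using pos[OF s] by (intro exI[of _ "\<lambda>t. E t / E s"]) (auto simp: kappa_eq)
    fix z assume "\<exists>y. (\<forall>r\<in>ts_kappa S. has_delta_derivative S y (1 * y r) r) \<and> y s = 1 \<and> z = y t"
    then obtain y where y: "\<And>r. r \<in> ts_kappa S \<Longrightarrow> has_delta_derivative S y (y r) r"
      and ys: "y s = 1" "z = y t" by auto
    have "continuous_on S (\<lambda>r. y r / E r)"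
      using pos by (intro continuous_intros cE delta_differentiable_imp_continuous_on[OF y]) force+
    moreover have "has_delta_derivative S (\<lambda>r. y r / E r) 0 r" if r: "r \<in> S" "r < b" for r
    proof -
      have "has_delta_derivative S y (y r) r" using y r by (auto simp: kappa_eq)
      from delta_derivative_divide[OF r(1) this E(2)[OF r(1)]] show ?thesis
        using pos[OF r(1)] pos[OF fwd_jump_mem[OF r(1)]] by simp
    qed
    ultimately have "y r / E r = y a / E a" if "r \<in> S" for r
      using delta_derivative_zero_imp_const[of "\<lambda>r. y r / E r" r] that by blast
    from this[OF s] this[OF t] have "y t / E t = 1 / E s" using ys by simp
    then show "z = E t / E s" using pos[OF t] ys by (simp add: field_simps)
  qed
  have e: "e1 t = E t" if "t \<in> S" for t using eq[OF min_in that] E(1) by simp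
  show "e1 a = 1" using e[OF min_in] E(1) by simp
  show "has_delta_derivative S e1 (e1 s) s" if "s \<in> S" for s
    using delta_derivative_cong[OF e that] E(2)[OF that] e[OF that] by simp
  show "1 \<le> e1 s" if "s \<in> S" for s using E(3) e that by simp
  show "continuous_on S e1" using cE by (simp cong: continuous_on_cong add: e)
  show "ts_exp S (\<lambda>_. 1) t s = e1 t / e1 s" if "s \<in> S" "t \<in> S" for s t
    using eq e that by simp
qed

lemma one_plus_delta_integral_exp:
  assumes t: "t \<in> S"
  shows "1 + delta_integral S a t (\<lambda>s. ts_exp S (\<lambda>_. 1) t (\<sigma> s)) = e1 t"
proof -
  have pos: "e1 s > 0" if "s \<in> S" for s using e1_ge_1[OF that] by simp
  have at: "a \<le> t" using in_bounds t by auto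
  have "has_delta_derivative S (\<lambda>s. - e1 t / e1 s) (ts_exp S (\<lambda>_. 1) t (\<sigma> s)) s" if s: "s \<in> S" for s
    using delta_derivative_divide[OF s delta_derivative_const[OF s, of "- e1 t"] e1_derivative[OF s]]
      pos[OF s] pos[OF fwd_jump_mem[OF s]] ts_exp_1[OF fwd_jump_mem[OF s] t] by simp
  moreover have "continuous_on S (\<lambda>s. - e1 t / e1 s)"
    using pos by (intro continuous_intros e1_continuous) force
  ultimately have "has_delta_integral S (\<lambda>s. ts_exp S (\<lambda>_. 1) t (\<sigma> s)) a t (- e1 t / e1 t - (- e1 t / e1 a))"
    by (rule has_delta_integral_primitive[OF min_in t at, rotated])
  from delta_integral_eq[OF min_in t at this] show ?thesis using pos[OF t] e1_min by simp
qed

lemma gronwall: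
  assumes cont: "continuous_on S y" and t: "t \<in> S" and c: "rd_continuous_on S S c"
    and y': "\<And>s. s \<in> S \<Longrightarrow> s < b \<Longrightarrow> has_delta_derivative S y (y' s) s"
    and le: "\<And>s. s \<in> S \<Longrightarrow> s < b \<Longrightarrow> y' s \<le> y s + c s"
    and nonneg: "\<And>s. s \<in> S \<Longrightarrow> s < b \<Longrightarrow> 0 \<le> c s"
  shows "y t \<le> e1 t * (y a + delta_integral S a t c)"
proof -
  have pos: "e1 s > 0" if "s \<in> S" for s using e1_ge_1[OF that] by simp
  have at: "a \<le> t" "t \<le> b" using in_bounds t by auto
  have "y t / e1 t - y a / e1 a \<le> delta_integral S a t c - delta_integral S a a c"
  proof (rule delta_derivative_increment_le[OF min_in t at(1)])
    show "continuous_on S (\<lambda>s. y s / e1 s)"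
      using pos by (intro continuous_intros cont e1_continuous) force
    show "continuous_on S (\<lambda>t. delta_integral S a t c)" by (rule delta_integral_continuous[OF c])
    fix s assume s: "s \<in> S" "s < t"
    then have sb: "s < b" using at by simp
    note p = pos[OF s(1)] pos[OF fwd_jump_mem[OF s(1)]]
    show "has_delta_derivative S (\<lambda>s. y s / e1 s)
        ((y' s * e1 s - y s * e1 s) / (e1 s * e1 (\<sigma> s))) s"
      by (rule delta_derivative_divide[OF s(1) y'[OF s(1) sb] e1_derivative[OF s(1)]]) (use p in auto)
    show "has_delta_derivative S (\<lambda>t. delta_integral S a t c) (c s) s"
      by (rule delta_integral_derivative[OF c s(1)])
    have "(y' s * e1 s - y s * e1 s) / (e1 s * e1 (\<sigma> s)) = (y' s - y s) / e1 (\<sigma> s)"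
      using p by (simp add: field_simps)
    also have "\<dots> \<le> c s / e1 (\<sigma> s)"
      using le[OF s(1) sb] p by (intro divide_right_mono) auto
    also have "\<dots> \<le> c s"
      using mult_left_mono[OF e1_ge_1[OF fwd_jump_mem[OF s(1)]] nonneg[OF s(1) sb]] p
      by (simp add: field_simps)
    finally show "(y' s * e1 s - y s * e1 s) / (e1 s * e1 (\<sigma> s)) \<le> c s" .
  qed
  then show ?thesis using pos[OF t] by (simp add: e1_min delta_integral_min[OF c] field_simps)
qed

text \<open>The concavity assumption on \<open>\<Psi>\<close> replaces the chain rule, which fails at scattered points.\<close>
lemma bihari:
  assumes cont: "continuous_on S Z" and t: "t \<in> S" and g: "rd_continuous_on S S g"
    and Z': "\<And>s. s \<in> S \<Longrightarrow> s < b \<Longrightarrow> has_delta_derivative S Z (Z' s) s"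
    and Z'_ge: "\<And>s. s \<in> S \<Longrightarrow> s < b \<Longrightarrow> 0 \<le> Z' s"
    and Z'_le: "\<And>s. s \<in> S \<Longrightarrow> s < b \<Longrightarrow> Z' s \<le> g s * \<Phi> (Z s)"
    and Za: "0 < Z a"
    and \<Phi>: "\<And>x. 0 < x \<Longrightarrow> 0 < \<Phi> x"
    and \<Psi>_cont: "continuous_on {0<..} \<Psi>"
    and \<Psi>: "\<And>x y. 0 < x \<Longrightarrow> x \<le> y \<Longrightarrow> \<Psi> y - \<Psi> x \<le> (y - x) / \<Phi> x"
  shows "\<Psi> (Z t) \<le> \<Psi> (Z a) + delta_integral S a t g"
proof -
  let ?G = "\<lambda>t. delta_integral S a t g"
  have at: "a \<le> t" "t \<le> b" using in_bounds t by auto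
  have mono: "Z r \<le> Z s" if "r \<in> S" "s \<in> S" "r \<le> s" for r s
  proof -
    have "0 - 0 \<le> Z s - Z r"
      by (rule delta_derivative_increment_le[OF that, of "\<lambda>_. 0" _ "\<lambda>_. 0" Z'])
         (use cont Z' Z'_ge less_le_trans[OF _ in_bounds(2)[OF that(2)]] in
          \<open>auto intro: delta_derivative_const\<close>)
    then show ?thesis by simp
  qed
  have pos: "0 < Z s" if "s \<in> S" for s
    using mono[OF min_in that] in_bounds(1)[OF that] Za by simp
  have "?G a - \<Psi> (Z a) \<le> ?G t - \<Psi> (Z t)"
  proof (rule dini_nonneg_imp_le_restrict[OF min_in t at(1)])
    show "continuous_on S (\<lambda>t. ?G t - \<Psi> (Z t))"
      using pos by (intro continuous_intros delta_integral_continuous[OF g]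
          continuous_on_compose2[OF \<Psi>_cont cont]) auto
    fix s e :: real assume s: "s \<in> S" "s < t" and e: "0 < e"
    then have sb: "s < b" using at by simp
    \<comment> \<open>The coefficient \<open>1 / \<Phi> (Z s)\<close> is frozen at \<open>s\<close>,
      so only linear rules are needed. As \<open>Z\<close> increases, \<open>\<Psi> (Z r)\<close>
      lies below the tangent at \<open>Z s\<close>, and the lower bound passes to
      \<open>?G - \<Psi> (Z)\<close>.\<close>
    have D: "has_delta_derivative S (\<lambda>r. ?G r - 1 / \<Phi> (Z s) * Z r) (g s - 1 / \<Phi> (Z s) * Z' s) s"
      by (intro delta_derivative_diff delta_derivative_cmult delta_integral_derivative g Z' s sb)
    have "0 \<le> g s - 1 / \<Phi> (Z s) * Z' s"
      using Z'_le[OF s(1) sb] \<Phi>[OF pos[OF s(1)]] by (simp add: field_simps)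
    from delta_derivative_lower[OF s(1) D this e] obtain d where "d > 0"
      and d: "\<And>r. r \<in> S \<Longrightarrow> s < r \<Longrightarrow> r < s + d \<or> r = \<sigma> s \<Longrightarrow>
        ?G s - 1 / \<Phi> (Z s) * Z s - e * (r - s) \<le> ?G r - 1 / \<Phi> (Z s) * Z r" by blast
    have "?G s - \<Psi> (Z s) - e * (r - s) \<le> ?G r - \<Psi> (Z r)"
      if r: "r \<in> S" "s < r" "r < s + d \<or> r = \<sigma> s" for r
    proof -
      have "\<Psi> (Z r) - \<Psi> (Z s) \<le> (Z r - Z s) / \<Phi> (Z s)"
        using mono[OF s(1) r(1)] r(2) by (intro \<Psi> pos s) auto
      then show ?thesis using d[OF r] by (simp add: diff_divide_distrib)
    qed
    then show "\<exists>d>0. \<forall>r\<in>S. s < r \<longrightarrow> r < s + d \<or> r = \<sigma> s \<longrightarrow>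
        ?G s - \<Psi> (Z s) - e * (r - s) \<le> ?G r - \<Psi> (Z r)"
      using \<open>d > 0\<close> by blast
  qed
  then show ?thesis by (simp add: delta_integral_min[OF g])
qed

end

subsection \<open>The estimate\<close>

text \<open>The assumption \<open>0 < xi\<close> expresses that \<open>\<Psi> xi\<close> is
  meaningful, \<open>\<Psi>\<close> being defined on the positive half-line; accordingly the domain
  of the inverse is the image of that half-line.\<close>

theorem theorem5:
  fixes T Ts :: "real set"
    and a b ua x0 xi t :: real
    and F :: "real \<Rightarrow> real \<Rightarrow> real \<Rightarrow> real"
    and K :: "real \<Rightarrow> real \<Rightarrow> real"
    and u h \<Phi> p \<Psi> \<Psi>inv :: "real \<Rightarrow> real"
  assumes "closed T" and "a \<in> T" and "b \<in> T" and "a < b"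
    and "Ts = T \<inter> {a..b}"
    and "rd_continuous_several Ts (\<lambda>t (x, y). F t x y)"
    and "rd_continuous_several Ts K"
    and "ivp_solution Ts a F K ua u"
    and "\<And>v. ivp_solution Ts a F K ua v \<Longrightarrow> \<forall>t\<in>Ts. v t = u t"
    and "\<And>t x. t \<in> ts_kappa Ts \<Longrightarrow> \<bar>K t x\<bar> \<le> h t * \<Phi> \<bar>x\<bar>"
    and "\<And>t x y. t \<in> Ts \<Longrightarrow> \<bar>F t x y\<bar> \<le> \<bar>x\<bar> + \<bar>y\<bar>"
    and "\<And>t. t \<in> ts_kappa Ts \<Longrightarrow> 0 \<le> h t"
    and "rd_continuous_on Ts (ts_kappa Ts) h"
    and "continuous_on {0..} \<Phi>"
    and "\<And>x. 0 \<le> x \<Longrightarrow> 0 \<le> \<Phi> x"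
    and "mono_on {0..} \<Phi>"
    and "\<And>x y. 0 \<le> x \<Longrightarrow> 0 \<le> y \<Longrightarrow> \<Phi> (x + y) \<le> \<Phi> x + \<Phi> y"
    and "\<And>x y. 0 \<le> x \<Longrightarrow> 0 \<le> y \<Longrightarrow> \<Phi> (x * y) \<le> \<Phi> x * \<Phi> y"
    and "\<And>x. 0 < x \<Longrightarrow> 0 < \<Phi> x"
    and "p = (\<lambda>t. 1 + delta_integral Ts a t (\<lambda>s. ts_exp Ts (\<lambda>_. 1) t (fwd_jump Ts s)))"
    and "xi = delta_integral Ts a (bwd_jump Ts b) (\<lambda>s. \<Phi> (p s * \<bar>ua\<bar>))"
    and "0 < x0"
    and "\<Psi> = (\<lambda>x. LBINT s=ereal x0..ereal x. 1 / \<Phi> s)"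
    and "\<Psi>inv = the_inv_into {0<..} \<Psi>"
    and "t \<in> Ts"
    and "0 < xi"
    and "\<Psi> xi + delta_integral Ts a (bwd_jump Ts t)
           (\<lambda>\<tau>. \<Phi> (p \<tau>) * \<Phi> (delta_integral Ts a \<tau> h)) \<in> \<Psi> ` {0<..}"
  shows "\<bar>u t\<bar> \<le> p t * (\<bar>ua\<bar> + delta_integral Ts a t (\<lambda>s. h s * \<Psi>inv
           (\<Psi> xi + delta_integral Ts a s (\<lambda>\<tau>. \<Phi> (p \<tau>) * \<Phi> (delta_integral Ts a \<tau> h)))))"
proof -
  interpret compact_time_scale Ts a b
    using assms(1-5) by unfold_locales (auto intro: closed_Int_compact)
  note sol = assms(8) and K_le = assms(10) and F_le = assms(11) and h_ge = assms(12)
    and \<Phi>_cont = assms(14) and \<Phi>_ge = assms(15) and \<Phi>_add = assms(17) and \<Phi>_mult = assms(18)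
    and \<Phi>_pos = assms(19) and t = assms(25) and xi_pos = assms(26)
  let ?I = "\<lambda>f t. delta_integral Ts a t f"
  have \<Phi>_mono: "\<Phi> x \<le> \<Phi> y" if "0 \<le> x" "x \<le> y" for x y
    using assms(16) that by (auto simp: mono_on_def)
  have below_max: "s \<in> ts_kappa Ts" if "s \<in> Ts" "s < b" for s using that by (simp add: kappa_eq)
  have kappa_sub: "s \<in> Ts" if "s \<in> ts_kappa Ts" for s using that by (simp add: kappa_eq)
  have h_nonneg: "0 \<le> h s" if "s \<in> Ts" "s < b" for s using h_ge below_max that by blast
  have h_rd: "rd_continuous_on Ts Ts h" by (rule rd_continuous_on_kappa) fact

  \<comment> \<open>The coefficients of the estimate\<close>
  have p: "p s = e1 s" if "s \<in> Ts" for s using one_plus_delta_integral_exp[OF that] assms(20) by simp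
  have e1_nonneg: "0 \<le> e1 s" if "s \<in> Ts" for s using e1_ge_1[OF that] by simp
  define g where "g s = \<Phi> (e1 s) * \<Phi> (?I h s)" for s
  have g_eq: "delta_integral Ts a s (\<lambda>\<tau>. \<Phi> (p \<tau>) * \<Phi> (delta_integral Ts a \<tau> h)) = ?I g s" for s
    by (rule delta_integral_cong) (simp add: p g_def)
  have Ih_nonneg: "0 \<le> ?I h s" if "s \<in> Ts" for s
    by (rule delta_integral_nonneg[OF h_rd that]) (use h_nonneg in_bounds(2)[OF that] in auto)
  have comp_cont: "continuous_on Ts (\<lambda>s. \<Phi> (f s))"
    if "continuous_on Ts f" "\<And>s. s \<in> Ts \<Longrightarrow> 0 \<le> f s" for f
    by (rule continuous_on_compose2[OF \<Phi>_cont that(1)]) (use that(2) in auto)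
  have g_cont: "continuous_on Ts g"
    unfolding g_def
    by (intro continuous_intros comp_cont e1_continuous delta_integral_continuous h_rd e1_nonneg Ih_nonneg)
  have g_nonneg: "0 \<le> g s" if "s \<in> Ts" for s
    unfolding g_def by (intro mult_nonneg_nonneg \<Phi>_ge e1_nonneg Ih_nonneg that)
  note g_rd = continuous_imp_rd_continuous[OF g_cont]

  \<comment> \<open>The solution and the bound on its derivative\<close>
  define u' where "u' s = F s (u s) (?I (\<lambda>r. K s (u r)) s)" for s
  have ua: "u a = ua" and u': "\<And>s. s \<in> ts_kappa Ts \<Longrightarrow> has_delta_derivative Ts u (u' s) s"
    and K_int: "\<And>s. s \<in> ts_kappa Ts \<Longrightarrow> delta_integrable Ts (\<lambda>r. K s (u r)) a s"
    using sol by (auto simp: ivp_solution_def u'_def)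
  have u_cont: "continuous_on Ts u" by (rule delta_differentiable_imp_continuous_on[OF u'])
  have \<Phi>u_cont: "continuous_on Ts (\<lambda>s. \<Phi> \<bar>u s\<bar>)"
    by (intro comp_cont continuous_intros u_cont) auto
  note \<Phi>u_rd = continuous_imp_rd_continuous[OF \<Phi>u_cont]
  define z where "z = ?I (\<lambda>s. \<Phi> \<bar>u s\<bar>)"
  have z_cont: "continuous_on Ts z" unfolding z_def by (rule delta_integral_continuous[OF \<Phi>u_rd])
  have z': "has_delta_derivative Ts z (\<Phi> \<bar>u s\<bar>) s" if "s \<in> Ts" for s
    unfolding z_def by (rule delta_integral_derivative[OF \<Phi>u_rd that])
  have za: "z a = 0" unfolding z_def by (rule delta_integral_min[OF \<Phi>u_rd])
  have z_mono: "z r \<le> z s" if "r \<in> Ts" "s \<in> Ts" "r \<le> s" for r s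
    unfolding z_def by (rule delta_integral_increasing[OF \<Phi>u_rd that]) (simp add: \<Phi>_ge)
  have z_nonneg: "0 \<le> z s" if "s \<in> Ts" for s
    using z_mono[OF min_in that] in_bounds(1)[OF that] za by simp

  have inner_le: "\<bar>?I (\<lambda>r. K s (u r)) s\<bar> \<le> h s * z s" if s: "s \<in> ts_kappa Ts" for s
  proof -
    have s_in: "s \<in> Ts" and as: "a \<le> s" using kappa_sub[OF s] in_bounds by auto
    \<comment> \<open>With \<open>s\<close> frozen in the first argument of \<open>K\<close>,
      existence of the inner integral is part of being a solution; its value is then squeezed
      between multiples of \<open>z s\<close>.\<close>
    obtain J where J: "has_delta_integral Ts (\<lambda>r. K s (u r)) a s J"
      using K_int[OF s] by (auto simp: delta_integrable_def)
    have pr: "has_delta_integral Ts (\<lambda>r. c * \<Phi> \<bar>u r\<bar>) a s (c * z s)" for c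
    proof -
      have "has_delta_integral Ts (\<lambda>r. c * \<Phi> \<bar>u r\<bar>) a s (c * z s - c * z a)"
        by (rule has_delta_integral_primitive[OF min_in s_in as])
           (auto intro!: continuous_intros z_cont delta_derivative_cmult z')
      then show ?thesis by (simp add: za)
    qed
    have K: "K s x \<le> h s * \<Phi> \<bar>x\<bar>" "- h s * \<Phi> \<bar>x\<bar> \<le> K s x" for x
      using K_le[OF s, of x] by (auto simp: abs_le_iff)
    have "J \<le> h s * z s"
      by (rule has_delta_integral_mono[OF min_in s_in as J pr K(1)])
    moreover have "- h s * z s \<le> J"
      by (rule has_delta_integral_mono[OF min_in s_in as pr J K(2)])
    ultimately show ?thesis using delta_integral_eq[OF min_in s_in as J] by simp
  qed
  define c where "c s = h s * z s" for s
  have c_rd: "rd_continuous_on Ts Ts c"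
    unfolding c_def by (intro rd_continuous_mult h_rd continuous_imp_rd_continuous z_cont)
  have c_nonneg: "0 \<le> c s" if "s \<in> Ts" "s < b" for s
    unfolding c_def using h_nonneg z_nonneg that by simp
  have Ic_nonneg: "0 \<le> ?I c s" if "s \<in> Ts" for s
    by (rule delta_integral_nonneg[OF c_rd that]) (use c_nonneg in_bounds(2)[OF that] in auto)
  have u'_le: "\<bar>u' s\<bar> \<le> \<bar>u s\<bar> + c s" if "s \<in> Ts" "s < b" for s
    using F_le[OF that(1), of "u s" "?I (\<lambda>r. K s (u r)) s"] inner_le[OF below_max[OF that]]
    by (simp add: u'_def c_def)

  \<comment> \<open>The linear bound on the solution\<close>
  have y_rd: "rd_continuous_on Ts Ts (\<lambda>s. \<bar>u s\<bar> + c s)"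
    by (intro rd_continuous_add c_rd continuous_imp_rd_continuous continuous_intros u_cont)
  \<comment> \<open>\<open>|u|\<close> need not be differentiable. Its majorant \<open>y\<close> has
    derivative exactly \<open>|u| + c\<close>, which is at most \<open>y + c\<close> once
    \<open>|u| \<le> y\<close> is known.\<close>
  define y where "y s = \<bar>ua\<bar> + ?I (\<lambda>s. \<bar>u s\<bar> + c s) s" for s
  have y_cont: "continuous_on Ts y"
    unfolding y_def by (intro continuous_intros delta_integral_continuous y_rd)
  have y': "has_delta_derivative Ts y (\<bar>u s\<bar> + c s) s" if "s \<in> Ts" for s
    using delta_derivative_add[OF that delta_derivative_const[OF that]
        delta_integral_derivative[OF y_rd that]] by (simp add: y_def[abs_def])
  have ya: "y a = \<bar>ua\<bar>" by (simp add: y_def delta_integral_min[OF y_rd])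
  have u_le_y: "\<bar>u s\<bar> \<le> y s" if s: "s \<in> Ts" for s
  proof -
    have as: "a \<le> s" and sb: "s \<le> b" using in_bounds s by auto
    have k: "r \<in> ts_kappa Ts" if "r \<in> Ts" "r < s" for r using below_max that sb by simp
    have le: "u' r \<le> \<bar>u r\<bar> + c r" "- u' r \<le> \<bar>u r\<bar> + c r" if "r \<in> Ts" "r < s" for r
      using u'_le[OF that(1)] that sb by auto
    have "u s - u a \<le> y s - y a"
      by (rule delta_derivative_increment_le[OF min_in s as u_cont y_cont u'[OF k] y' le(1)])
    moreover have "- u s - - u a \<le> y s - y a"
      by (rule delta_derivative_increment_le[OF min_in s as continuous_on_minus[OF u_cont] y_cont
            delta_derivative_minus[OF _ u'[OF k]] y' le(2)])
    ultimately show ?thesis using ua ya by linarith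
  qed
  have u_le: "\<bar>u s\<bar> \<le> e1 s * (\<bar>ua\<bar> + ?I c s)" if s: "s \<in> Ts" for s
  proof -
    have "y s \<le> e1 s * (y a + ?I c s)"
      by (rule gronwall[OF y_cont s c_rd y']) (use u_le_y c_nonneg in auto)
    then show ?thesis using u_le_y[OF s] ya by simp
  qed

  \<comment> \<open>The nonlinear inequality for \<open>z\<close> and its majorant
    \<open>Z\<close>\<close>
  define \<phi> where "\<phi> s = \<Phi> (e1 s * \<bar>ua\<bar>)" for s
  have \<phi>_rd: "rd_continuous_on Ts Ts \<phi>"
    unfolding \<phi>_def
    by (intro continuous_imp_rd_continuous comp_cont continuous_intros e1_continuous
        mult_nonneg_nonneg e1_nonneg abs_ge_zero)
  have \<phi>_nonneg: "0 \<le> \<phi> s" if "s \<in> Ts" for s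
    unfolding \<phi>_def using e1_nonneg[OF that] by (simp add: \<Phi>_ge)
  have xi: "xi = ?I \<phi> (bwd_jump Ts b)"
    unfolding assms(21) by (rule delta_integral_cong) (simp add: p \<phi>_def)
  have Ic_le: "?I c s \<le> ?I h s * z s" if s: "s \<in> Ts" for s
  proof -
    have as: "a \<le> s" and sb: "s \<le> b" using in_bounds s by auto
    have "?I c s - ?I c a \<le> z s * ?I h s - z s * ?I h a"
    proof (rule delta_derivative_increment_le[OF min_in s as, of "?I c" _ c "\<lambda>r. z s * h r"])
      show "continuous_on Ts (?I c)" by (rule delta_integral_continuous[OF c_rd])
      show "continuous_on Ts (\<lambda>r. z s * ?I h r)"
        by (intro continuous_intros delta_integral_continuous[OF h_rd])
      fix r assume r: "r \<in> Ts" "r < s"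
      show "has_delta_derivative Ts (?I c) (c r) r" by (rule delta_integral_derivative[OF c_rd r(1)])
      show "has_delta_derivative Ts (\<lambda>r. z s * ?I h r) (z s * h r) r"
        by (intro delta_derivative_cmult delta_integral_derivative h_rd r)
      show "c r \<le> z s * h r"
        using mult_left_mono[OF z_mono[OF r(1) s] h_nonneg[OF r(1)]] r sb
        by (simp add: c_def mult.commute)
    qed
    then show ?thesis by (simp add: delta_integral_min c_rd h_rd mult.commute)
  qed
  define w where "w s = g s * \<Phi> (z s)" for s
  have w_rd: "rd_continuous_on Ts Ts w"
    unfolding w_def by (intro continuous_imp_rd_continuous continuous_intros g_cont comp_cont z_cont z_nonneg)
  have w_nonneg: "0 \<le> w s" if "s \<in> Ts" for s
    unfolding w_def by (intro mult_nonneg_nonneg g_nonneg \<Phi>_ge z_nonneg that)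
  have z'_le: "\<Phi> \<bar>u s\<bar> \<le> \<phi> s + w s" if s: "s \<in> Ts" for s
  proof -
    note nn = e1_nonneg[OF s] Ic_nonneg[OF s] Ih_nonneg[OF s] z_nonneg[OF s]
    have "\<Phi> \<bar>u s\<bar> \<le> \<Phi> (e1 s * \<bar>ua\<bar> + e1 s * ?I c s)"
      using u_le[OF s] by (intro \<Phi>_mono) (auto simp: distrib_left)
    also have "\<dots> \<le> \<phi> s + \<Phi> (e1 s * ?I c s)"
      unfolding \<phi>_def using nn by (intro \<Phi>_add) auto
    also have "\<Phi> (e1 s * ?I c s) \<le> \<Phi> (e1 s) * \<Phi> (?I c s)" using nn by (intro \<Phi>_mult)
    also have "\<Phi> (?I c s) \<le> \<Phi> (?I h s * z s)" using Ic_le[OF s] nn by (intro \<Phi>_mono)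
    also have "\<dots> \<le> \<Phi> (?I h s) * \<Phi> (z s)" using nn by (intro \<Phi>_mult)
    finally show ?thesis
      using \<Phi>_ge[OF nn(1)] by (simp add: w_def g_def mult_left_mono mult.assoc)
  qed
  \<comment> \<open>Starting from the constant \<open>xi\<close>, not from the running integral of
    \<open>\<phi>\<close>, leaves \<open>w\<close> as the whole derivative, and positivity of
    \<open>xi\<close> keeps \<open>Z\<close> in the domain of \<open>\<Psi>\<close>.\<close>
  define Z where "Z s = xi + ?I w s" for s
  have Z_cont: "continuous_on Ts Z"
    unfolding Z_def by (intro continuous_intros delta_integral_continuous w_rd)
  have Z': "has_delta_derivative Ts Z (w s) s" if "s \<in> Ts" for s
    using delta_derivative_add[OF that delta_derivative_const[OF that]
        delta_integral_derivative[OF w_rd that]] by (simp add: Z_def[abs_def])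
  have Za: "Z a = xi" by (simp add: Z_def delta_integral_min[OF w_rd])
  have Z_pos: "0 < Z s" if "s \<in> Ts" for s
    using delta_integral_nonneg[OF w_rd that w_nonneg] xi_pos by (simp add: Z_def)
  have z_le_Z: "z s \<le> Z s" if s: "s \<in> Ts" "s < b" for s
  proof -
    have as: "a \<le> s" using in_bounds s by auto
    have "z s - z a \<le> (?I \<phi> s + ?I w s) - (?I \<phi> a + ?I w a)"
      by (rule delta_derivative_increment_le[OF min_in s(1) as z_cont _ z'
            delta_derivative_add[OF _ delta_integral_derivative[OF \<phi>_rd]
              delta_integral_derivative[OF w_rd]] z'_le])
         (auto intro!: continuous_intros delta_integral_continuous \<phi>_rd w_rd)
    \<comment> \<open>Here \<open>s < b\<close> matters: it gives
      \<open>s \<le> bwd_jump Ts b\<close>, the upper limit in \<open>xi\<close>.\<close>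
    moreover have "?I \<phi> s \<le> xi"
      unfolding xi using s
      by (intro delta_integral_increasing[OF \<phi>_rd] bwd_jump_mem bwd_jump_ge max_in \<phi>_nonneg)
    ultimately show ?thesis by (simp add: Z_def za delta_integral_min \<phi>_rd w_rd)
  qed

  \<comment> \<open>Monotonicity and concavity of \<open>\<Psi>\<close>\<close>
  have inv\<Phi>_cont: "continuous_on {0<..} (\<lambda>s. 1 / \<Phi> s)"
    by (intro continuous_intros continuous_on_subset[OF \<Phi>_cont]) (auto dest: \<Phi>_pos)
  have \<Psi>': "(\<Psi> has_real_derivative 1 / \<Phi> x) (at x)" if "0 < x" for x
    unfolding assms(23) by (rule interval_integral_has_real_derivative[OF inv\<Phi>_cont assms(22) that])
  have \<Psi>_cont: "continuous_on {0<..} \<Psi>"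
    using \<Psi>' by (meson DERIV_isCont continuous_at_imp_continuous_on greaterThan_iff)
  have \<Psi>_less: "\<Psi> x < \<Psi> y" if "0 < x" "x < y" for x y
    by (rule DERIV_pos_imp_increasing[OF that(2)])
       (use \<Psi>' \<Phi>_pos that in \<open>metis less_le_trans zero_less_divide_1_iff\<close>)
  have \<Psi>_inj: "inj_on \<Psi> {0<..}"
    by (rule linorder_inj_onI) (use \<Psi>_less in \<open>force\<close>)+
  have \<Psi>_concave: "\<Psi> y - \<Psi> x \<le> (y - x) / \<Phi> x" if "0 < x" "x \<le> y" for x y
  proof (cases "x = y")
    case False
    with that have "x < y" by simp
    moreover have "(\<Psi> has_real_derivative 1 / \<Phi> v) (at v)" if "x \<le> v" for v
      using \<Psi>' \<open>0 < x\<close> that by simp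
    ultimately obtain v where v: "x < v" "v < y" "\<Psi> y - \<Psi> x = (y - x) * (1 / \<Phi> v)"
      using MVT2[of x y \<Psi> "\<lambda>x. 1 / \<Phi> x"] by blast
    \<comment> \<open>The mean value slope is taken at some \<open>v > x\<close>, where
      \<open>1 / \<Phi>\<close> is no larger than at \<open>x\<close>.\<close>
    have "(y - x) / \<Phi> v \<le> (y - x) / \<Phi> x"
      using that v \<Phi>_pos[of x] \<Phi>_mono[of x v] by (intro divide_left_mono mult_pos_pos) (auto intro: \<Phi>_pos)
    then show ?thesis using v by simp
  qed simp
  have \<Psi>Z: "\<Psi> (Z s) \<le> \<Psi> xi + ?I g s" if s: "s \<in> Ts" for s
    unfolding Za[symmetric]
  proof (rule bihari[where \<Phi> = \<Phi> and \<Psi> = \<Psi>, OF Z_cont s g_rd Z' w_nonneg])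
    show "w r \<le> g r * \<Phi> (Z r)" if "r \<in> Ts" "r < b" for r
      unfolding w_def
      using z_le_Z[OF that] z_nonneg[OF that(1)] g_nonneg[OF that(1)]
      by (intro mult_left_mono \<Phi>_mono)
  qed (use Za xi_pos \<Phi>_pos \<Psi>_cont \<Psi>_concave in auto)

  \<comment> \<open>Inverting \<open>\<Psi>\<close> before time \<open>t\<close>\<close>
  have \<rho>: "bwd_jump Ts t \<in> Ts" using bwd_jump_mem[OF t] .
  define V where "V = ?I g (bwd_jump Ts t)"
  \<comment> \<open>The domain condition supplies \<open>x1\<close>. All intermediate values are
    then attained on \<open>{xi..x1}\<close>.\<close>
  obtain x1 where x1: "0 < x1" "\<Psi> x1 = \<Psi> xi + V"
    using assms(27) unfolding g_eq V_def by auto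
  have V: "0 \<le> V" unfolding V_def by (rule delta_integral_nonneg[OF g_rd \<rho> g_nonneg])
  have "xi \<le> x1"
    using \<Psi>_less[of x1 xi] x1 V by (cases "xi \<le> x1") auto
  text \<open>Truncating at \<open>V\<close> keeps the argument of \<open>\<Psi>inv\<close> in the range of \<open>\<Psi>\<close> on the whole time
    scale, without changing it before \<open>t\<close>.\<close>
  define m where "m s = \<Psi> xi + min (?I g s) V" for s
  have m_range: "m s \<in> \<Psi> ` {xi..x1}" if "s \<in> Ts" for s
  proof -
    have "\<Psi> xi \<le> m s" "m s \<le> \<Psi> x1"
      using delta_integral_nonneg[OF g_rd that g_nonneg] V x1 by (auto simp: m_def)
    moreover have "continuous_on {xi..x1} \<Psi>"
      using xi_pos by (intro continuous_on_subset[OF \<Psi>_cont]) auto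
    ultimately obtain x where "xi \<le> x" "x \<le> x1" "\<Psi> x = m s"
      using IVT'[of \<Psi> xi "m s" x1] \<open>xi \<le> x1\<close> by blast
    then show ?thesis by (intro image_eqI[of _ _ x]) auto
  qed
  have \<Psi>inv: "\<Psi>inv (\<Psi> x) = x" if "0 < x" for x
    unfolding assms(24) using that by (intro the_inv_into_f_f[OF \<Psi>_inj]) auto
  define W where "W s = \<Psi>inv (m s)" for s
  have m_cont: "continuous_on Ts m"
    unfolding m_def by (intro continuous_intros delta_integral_continuous g_rd)
  \<comment> \<open>The inverse of a continuous injection on a compact set is continuous; this makes
    \<open>h * W\<close> rd-continuous, hence integrable.\<close>
  have "continuous_on (\<Psi> ` {xi..x1}) \<Psi>inv"
    using xi_pos by (intro continuous_on_inv continuous_on_subset[OF \<Psi>_cont] ballI \<Psi>inv) auto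
  then have W_cont: "continuous_on Ts W"
    unfolding W_def by (rule continuous_on_compose2[OF _ m_cont]) (use m_range in auto)
  \<comment> \<open>A point \<open>s < t\<close> satisfies \<open>s \<le> bwd_jump Ts t\<close>, and
    \<open>g\<close> is nonnegative, so the minimum is not active.\<close>
  have m_eq: "m s = \<Psi> xi + ?I g s" if "s \<in> Ts" "s < t" for s
    using delta_integral_increasing[OF g_rd that(1) \<rho> bwd_jump_ge[OF t that] g_nonneg]
    by (simp add: m_def V_def)
  have z_le_W: "z s \<le> W s" if s: "s \<in> Ts" "s < t" for s
  proof -
    obtain x where x: "m s = \<Psi> x" "xi \<le> x" using m_range[OF s(1)] by auto
    then have "0 < x" using xi_pos by simp
    then have Wx: "W s = x" by (simp add: W_def x \<Psi>inv)
    have "\<Psi> (Z s) \<le> \<Psi> x" using \<Psi>Z[OF s(1)] m_eq[OF s] x by simp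
    then have "Z s \<le> x" using \<Psi>_less[OF \<open>0 < x\<close>, of "Z s"] by (cases "Z s \<le> x") auto
    then show ?thesis using z_le_Z[OF s(1)] s in_bounds(2)[OF t] Wx by simp
  qed
  have "?I c t \<le> ?I (\<lambda>s. h s * W s) t"
  proof (rule delta_integral_mono[OF c_rd _ t])
    show "rd_continuous_on Ts Ts (\<lambda>s. h s * W s)"
      by (intro rd_continuous_mult h_rd continuous_imp_rd_continuous W_cont)
    show "c s \<le> h s * W s" if "s \<in> Ts" "s < t" for s
      unfolding c_def using z_le_W[OF that] h_nonneg that in_bounds(2)[OF t]
      by (intro mult_left_mono) auto
  qed
  \<comment> \<open>From \<open>t\<close> on, the untruncated argument may leave the range of
    \<open>\<Psi>\<close>, but the integral up to \<open>t\<close> does not see those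
    points.\<close>
  also have "\<dots> = ?I (\<lambda>s. h s * \<Psi>inv (\<Psi> xi + ?I g s)) t"
    by (rule delta_integral_cong) (simp add: W_def m_eq)
  finally have "e1 t * (\<bar>ua\<bar> + ?I c t) \<le> e1 t * (\<bar>ua\<bar> + ?I (\<lambda>s. h s * \<Psi>inv (\<Psi> xi + ?I g s)) t)"
    using e1_nonneg[OF t] by (intro mult_left_mono) auto
  then show ?thesis using u_le[OF t] unfolding g_eq p[OF t] by linarith
qed

end
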